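(* Let $n\geq 1$, $d\geq 1$, and let $\vec p=(p_1,\ldots,p_{n+1})\in[1,\infty)^{n+1}$. Let $r_1,\ldots,r_{n+1}\in[1,\infty]$ satisfy \[ \frac{r_{n+1}}{r_{n+1}-1}=r:=\frac{1}{\sum_{j=1}^n \frac1{r_j}}, \] and assume $r_j>p_j$ for $j=1,\ldots,n+1$. Then for every $N\ge 1$ and every finite sequence $\mathbf T=\{T_1,\ldots,T_N\}$ of $n$-sublinear operators mapping $L^\infty_0(\mathbb R^d;\mathbb C)^n$ into locally integrable functions, \[ \|\{T_1,\ldots,T_N\}\|_{(\vec p,\vec r)}\le C \sup_{k=1,\ldots,N}\|T_k\|_{\vec p}, \] where $C$ depends only on $\vec p$, $\vec r=(r_1,\ldots,r_{n+1})$ and $d$ (in particular not on $N$ or on the operators).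
   Context: For $f$ locally $p$-integrable and a cube $Q\subset\mathbb R^d$, $\langle f\rangle_{p,Q}:=\|f\mathbf 1_Q\|_p/|Q|^{1/p}$. For $\mathbf a=(a_1,\dots,a_N)\in\mathbb C^N$, $\|\mathbf a\|_{\ell^r}=(\sum_k|a_k|^r)^{1/r}$ ($\sup_k|a_k|$ if $r=\infty$). A countable collection $\mathcal Q$ of cubes in $\mathbb R^d$ is sparse if there are pairwise disjoint sets $E_Q\subset Q$, $Q\in\mathcal Q$, with $|E_Q|>\frac12|Q|$. For an $n$-sublinear operator $T$ mapping $L^\infty_0(\mathbb R^d;\mathbb C)^n$ (bounded compactly supported functions) into locally integrable functions and $\vec p\in(0,\infty)^{n+1}$, the sparse $\vec p$ norm $\|T\|_{\vec p}$ is the least $C>0$ such that for all $(g^1,\ldots,g^{n+1})\in L^\infty_0(\mathbb R^d;\mathbb C)^{n+1}$ there is a sparse collection $\mathcal Q$ (depending on the $g^j$) with $|\langle T(g^1,\ldots,g^n),g^{n+1}\rangle|\le C\sum_{Q\in\mathcal Q}|Q|\prod_{j=1}^{n+1}\langle g^j\rangle_{p_j,Q}$. For $\mathbf T=\{T_1,\ldots,T_N\}$ acting on $\mathbf f^j=(f^j_1,\ldots,f^j_N)\in L^\infty_0(\mathbb R^d;\mathbb C^N)$, set $\langle\mathbf T(\mathbf f^1,\ldots,\mathbf f^n),\mathbf f^{n+1}\rangle:=\sum_{k=1}^N\langle T_k(f^1_k,\ldots,f^n_k),f^{n+1}_k\rangle$. The sparse $(\vec p,\vec r)$ norm $\|\mathbf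 T\|_{(\vec p,\vec r)}$ is the least $C>0$ such that for all $(\mathbf f^1,\ldots,\mathbf f^{n+1})\in L^\infty_0(\mathbb R^d;\mathbb C^N)^{n+1}$ there is a sparse collection $\mathcal Q$ with $|\langle\mathbf T(\mathbf f^1,\ldots,\mathbf f^n),\mathbf f^{n+1}\rangle|\le C\sum_{Q\in\mathcal Q}|Q|\prod_{j=1}^{n+1}\langle\|\mathbf f^j\|_{\ell^{r_j}}\rangle_{p_j,Q}$. *)

theory Defs
  imports "HOL-Analysis.Analysis"
begin

text \<open>Ambient space: an arbitrary Euclidean space 'a (playing the role of R^d, d = DIM('a) \<ge> 1).
  Tuples of n functions are represented as maps nat => ('a => complex), with the
  entries of index j < n being the actual arguments (0-based) and all other entries 0.\<close>

definition Linf0 :: "('a::euclidean_space \<Rightarrow> complex) set" where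
  "Linf0 = {f. f \<in> borel_measurable lebesgue \<and> bounded (range f) \<and> bounded {x. f x \<noteq> 0}}"

definition tuples :: "nat \<Rightarrow> (nat \<Rightarrow> 'a::euclidean_space \<Rightarrow> complex) set" where
  "tuples n = {g. (\<forall>j<n. g j \<in> Linf0) \<and> (\<forall>j\<ge>n. g j = (\<lambda>_. 0))}"

definition is_cube :: "'a::euclidean_space set \<Rightarrow> bool" where
  "is_cube Q \<longleftrightarrow> (\<exists>a l. l > 0 \<and> Q = cbox a (a + l *\<^sub>R One))"

definition sparse :: "'a::euclidean_space set set \<Rightarrow> bool" where
  "sparse \<Q> \<longleftrightarrow> countable \<Q> \<and> (\<forall>Q\<in>\<Q>. is_cube Q) \<and>
     (\<exists>E. (\<forall>Q\<in>\<Q>. E Q \<in> sets lebesgue \<and> E Q \<subseteq> Q \<and> measure lebesgue (E Q) > measure lebesgue Q / 2)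
          \<and> disjoint_family_on E \<Q>)"

definition avg :: "real \<Rightarrow> 'a::euclidean_space set \<Rightarrow> ('a \<Rightarrow> 'b::real_normed_vector) \<Rightarrow> real" where
  "avg p Q f = (set_lebesgue_integral lebesgue Q (\<lambda>x. norm (f x) powr p)) powr (1/p)
                / (measure lebesgue Q) powr (1/p)"

definition pairing :: "('a::euclidean_space \<Rightarrow> complex) \<Rightarrow> ('a \<Rightarrow> complex) \<Rightarrow> complex" where
  "pairing F h = (LINT x|lebesgue. F x * h x)"

definition nsublinear :: "nat \<Rightarrow> ((nat \<Rightarrow> 'a::euclidean_space \<Rightarrow> complex) \<Rightarrow> 'a \<Rightarrow> complex) \<Rightarrow> bool" where
  "nsublinear n T \<longleftrightarrow>
     (\<forall>g\<in>tuples n. \<forall>K. compact K \<longrightarrow> set_integrable lebesgue K (T g)) \<and>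
     (\<forall>g\<in>tuples n. \<forall>i<n. \<forall>f1\<in>Linf0. \<forall>f2\<in>Linf0.
        AE x in lebesgue. norm (T (g(i := (\<lambda>y. f1 y + f2 y))) x)
                          \<le> norm (T (g(i := f1)) x) + norm (T (g(i := f2)) x)) \<and>
     (\<forall>g\<in>tuples n. \<forall>i<n. \<forall>f\<in>Linf0. \<forall>c::complex.
        AE x in lebesgue. norm (T (g(i := (\<lambda>y. c * f y))) x) = norm c * norm (T (g(i := f)) x))"

text \<open>Sparse p-norm (p indexed 0..n, p n is the exponent of the dual function).\<close>
definition sparse_bound :: "nat \<Rightarrow> (nat \<Rightarrow> real) \<Rightarrow> ((nat \<Rightarrow> 'a::euclidean_space \<Rightarrow> complex) \<Rightarrow> 'a \<Rightarrow> complex) \<Rightarrow> real \<Rightarrow> bool" where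
  "sparse_bound n p T C \<longleftrightarrow>
     (\<forall>g\<in>tuples n. \<forall>h\<in>Linf0. \<exists>\<Q>. sparse \<Q> \<and>
        ennreal (norm (pairing (T g) h)) \<le>
          ennreal C * (\<Sum>\<^sub>\<infinity>Q\<in>\<Q>. ennreal (measure lebesgue Q * (\<Prod>j<n. avg (p j) Q (g j)) * avg (p n) Q h)))"

definition sparse_norm :: "nat \<Rightarrow> (nat \<Rightarrow> real) \<Rightarrow> ((nat \<Rightarrow> 'a::euclidean_space \<Rightarrow> complex) \<Rightarrow> 'a \<Rightarrow> complex) \<Rightarrow> ennreal" where
  "sparse_norm n p T = Inf {ennreal C | C. C > 0 \<and> sparse_bound n p T C}"

definition lr_norm :: "ereal \<Rightarrow> nat \<Rightarrow> (nat \<Rightarrow> complex) \<Rightarrow> real" where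
  "lr_norm r N v = (if r = \<infinity> then Max ((\<lambda>k. norm (v k)) ` {..<N})
                    else (\<Sum>k<N. norm (v k) powr real_of_ereal r) powr (1 / real_of_ereal r))"

definition recip :: "ereal \<Rightarrow> real" where
  "recip r = (if r = \<infinity> then 0 else 1 / real_of_ereal r)"

text \<open>Vector-valued tuples: F j k is the k-th component (k < N) of the j-th function (j < n).\<close>
definition vtuples :: "nat \<Rightarrow> nat \<Rightarrow> (nat \<Rightarrow> nat \<Rightarrow> 'a::euclidean_space \<Rightarrow> complex) set" where
  "vtuples n N = {F. (\<forall>j<n. \<forall>k<N. F j k \<in> Linf0) \<and> (\<forall>j\<ge>n. F j = (\<lambda>_ _. 0))}"

definition vsparse_bound :: "nat \<Rightarrow> (nat \<Rightarrow> real) \<Rightarrow> (nat \<Rightarrow> ereal) \<Rightarrow> nat \<Rightarrow>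
    (nat \<Rightarrow> (nat \<Rightarrow> 'a::euclidean_space \<Rightarrow> complex) \<Rightarrow> 'a \<Rightarrow> complex) \<Rightarrow> real \<Rightarrow> bool" where
  "vsparse_bound n p r N T C \<longleftrightarrow>
     (\<forall>F\<in>vtuples n N. \<forall>H. (\<forall>k<N. H k \<in> Linf0) \<longrightarrow> (\<exists>\<Q>. sparse \<Q> \<and>
        ennreal (norm (\<Sum>k<N. pairing (T k (\<lambda>j. F j k)) (H k))) \<le>
          ennreal C * (\<Sum>\<^sub>\<infinity>Q\<in>\<Q>. ennreal (measure lebesgue Q
              * (\<Prod>j<n. avg (p j) Q (\<lambda>x. lr_norm (r j) N (\<lambda>k. F j k x)))
              * avg (p n) Q (\<lambda>x. lr_norm (r n) N (\<lambda>k. H k x))))))"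

definition vsparse_norm :: "nat \<Rightarrow> (nat \<Rightarrow> real) \<Rightarrow> (nat \<Rightarrow> ereal) \<Rightarrow> nat \<Rightarrow>
    (nat \<Rightarrow> (nat \<Rightarrow> 'a::euclidean_space \<Rightarrow> complex) \<Rightarrow> 'a \<Rightarrow> complex) \<Rightarrow> ennreal" where
  "vsparse_norm n p r N T = Inf {ennreal C | C. C > 0 \<and> vsparse_bound n p r N T C}"

end

theory Submission
  imports Defs
begin

text \<open>
  Only the size of the operators enters: each \<open>T\<^sub>k\<close> is replaced by finitely many terms of its own sparse
  form, and it remains to dominate the sum over \<open>k\<close> of these forms by a single sparse form. The one-third
  trick moves all cubes into finitely many finite dyadic trees, where a sparse collection becomes a
  Carleson sequence of weights. In one tree, stop at the maximal cubes on which, for some \<open>j\<close>, the average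
  of the \<open>p\<^sub>j\<close>-th power of the \<open>r\<^sub>j\<close>-norm of \<open>f\<^sup>j\<close> exceeds a large multiple of its average on the root; these
  cubes cover little of the root, so iterating produces a sparse collection. Above the stopping cubes the
  averages are bounded, and there the weighted arithmetic-geometric mean inequality with weights \<open>1/r\<^sub>j\<close>
  reduces the product to single functions, which the Carleson embedding theorem in \<open>L\<^sup>q\<close>,
  \<open>q = r\<^sub>j / p\<^sub>j > 1\<close>, controls for every \<open>k\<close>. Minkowski's inequality sums over \<open>k\<close>.
\<close>

subsection \<open>Elementary inequalities\<close>

text \<open>The obstacle is that the sparse collections belonging to different \<open>T k\<close>
  have nothing in common, so their union need not be sparse with a constant free of
  \<open>N\<close>. The stopping rule therefore looks only at averages of the
  \<open>r j\<close>-norms, which do not depend on \<open>k\<close>; the collection of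
  \<open>T k\<close> survives only as a weight \<open>w k\<close>, whose Carleson condition is the
  one trace of its sparseness. The condition \<open>r j > p j\<close> is what makes
  \<open>q = r j / p j\<close> exceed 1. If \<open>r j\<close> is infinite, the weight
  \<open>1 / r j\<close> vanishes and the factor \<open>j\<close> is bounded by the stopping rule
  alone. Truncation to finitely many cubes costs a factor 2 and makes every tree finite, so that the
  stopping argument and the embedding become inductions on the depth with constants that do not
  deteriorate. Finally, one collection has to serve although the cubes are spread over
  \<open>2 ^ d\<close> trees; the tree with the largest resulting form is kept, at the cost of a
  factor \<open>2 ^ d\<close>.\<close>

lemma weighted_arith_geom_mean:
  fixes x e :: "'a \<Rightarrow> real"
  assumes "finite S" "\<And>i. i \<in> S \<Longrightarrow> 0 < e i" "(\<Sum>i\<in>S. e i) = 1" "\<And>i. i \<in> S \<Longrightarrow> 0 \<le> x i"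
  shows "(\<Prod>i\<in>S. x i powr e i) \<le> (\<Sum>i\<in>S. e i * x i)"
proof (cases "\<exists>i\<in>S. x i = 0")
  case True
  then have "(\<Prod>i\<in>S. x i powr e i) = 0"
    using assms(1) by (intro prod_zero) auto
  moreover have "0 \<le> (\<Sum>i\<in>S. e i * x i)"
    using assms by (intro sum_nonneg mult_nonneg_nonneg) (auto intro: less_imp_le)
  ultimately show ?thesis by simp
next
  case False
  then have pos: "0 < x i" if "i \<in> S" for i
    using assms(4) that by force
  have ne: "S \<noteq> {}" using assms(3) by auto
  have le: "(\<Sum>i\<in>S. e i * ln (x i)) \<le> ln (\<Sum>i\<in>S. e i *\<^sub>R x i)"
    using pos assms ne by (intro concave_on_sum[OF _ _ ln_concave]) (auto intro: less_imp_le)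
  have "0 < (\<Sum>i\<in>S. e i * x i)"
    using assms ne pos by (intro sum_pos mult_pos_pos) auto
  then have "exp (\<Sum>i\<in>S. e i * ln (x i)) \<le> (\<Sum>i\<in>S. e i * x i)"
    using le by (simp add: ln_ge_iff)
  moreover have "exp (\<Sum>i\<in>S. e i * ln (x i)) = (\<Prod>i\<in>S. x i powr e i)"
    using assms(1) by (auto simp: exp_sum powr_def dest: pos intro!: prod.cong)
  ultimately show ?thesis by simp
qed

text \<open>This is the tangent line inequality for \<open>y powr q / q\<close> at
  \<open>y = x\<close>. Both the convexity argument and Minkowski's inequality below use it in this
  form.\<close>

lemma Youngs_inequality_conjugate:
  fixes q x y :: real
  assumes "1 < q" "0 \<le> x" "0 \<le> y"
  shows "x powr (q - 1) * y \<le> (1 - 1/q) * x powr q + y powr q / q"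
proof -
  have "x powr (q - 1) * y \<le> (x powr (q - 1)) powr (q/(q-1)) / (q/(q-1)) + y powr q / q"
    using assms by (intro Youngs_inequality) (auto simp: field_simps)
  also have "(x powr (q - 1)) powr (q/(q-1)) / (q/(q-1)) = (1 - 1/q) * x powr q"
  proof -
    have "(q - 1) * (q / (q - 1)) = q" using assms by simp
    then show ?thesis using assms by (simp only: powr_powr) (simp add: field_simps)
  qed
  finally show ?thesis .
qed

text \<open>The function \<open>X powr q / U powr (q - 1)\<close> is the perspective of the convex
  function \<open>x powr q\<close>: convex and homogeneous of degree 1, hence subadditive. This is
  how the Bellman function passes from the children to their parent.\<close>

lemma sum_powr_perspective_le:
  fixes X U :: "'a \<Rightarrow> real"
  assumes "finite S" "1 < q" "\<And>s. s \<in> S \<Longrightarrow> 0 \<le> X s" "\<And>s. s \<in> S \<Longrightarrow> 0 < U s"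
  shows "(\<Sum>s\<in>S. X s) powr q / (\<Sum>s\<in>S. U s) powr (q - 1)
         \<le> (\<Sum>s\<in>S. X s powr q / U s powr (q - 1))"
proof (cases "S = {}")
  case False
  define XX UU where "XX = (\<Sum>s\<in>S. X s)" and "UU = (\<Sum>s\<in>S. U s)"
  have UU: "0 < UU" unfolding UU_def using assms False by (intro sum_pos) auto
  have XX: "0 \<le> XX" unfolding XX_def using assms by (intro sum_nonneg) auto
  define \<rho> where "\<rho> = XX / UU"
  have \<rho>: "0 \<le> \<rho>" using UU XX by (simp add: \<rho>_def)
  \<comment> \<open>Tangent plane of the perspective at the ratio \<open>\<rho>\<close> of the
    totals. By homogeneity it is linear, and it touches at the totals, so summing over
    \<open>S\<close> gives exactly the left-hand side.\<close>
  have pt: "q * \<rho> powr (q - 1) * X s - (q - 1) * \<rho> powr q * U s \<le> X s powr q / U s powr (q - 1)"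
    if s: "s \<in> S" for s
  proof -
    have Xs: "0 \<le> X s" and Us: "0 < U s" using assms s by auto
    have "\<rho> powr (q - 1) * (X s / U s) \<le> (1 - 1/q) * \<rho> powr q + (X s / U s) powr q / q"
      using assms(2) \<rho> Xs Us by (intro Youngs_inequality_conjugate) auto
    then have "q * U s * (\<rho> powr (q - 1) * (X s / U s))
        \<le> q * U s * ((1 - 1/q) * \<rho> powr q + (X s / U s) powr q / q)"
      using assms(2) Us by (intro mult_left_mono) auto
    also have "\<dots> = (q - 1) * \<rho> powr q * U s + U s * (X s / U s) powr q"
      using assms(2) by (simp add: field_simps)
    also have "U s * (X s / U s) powr q = X s powr q / U s powr (q - 1)"
      using Xs Us by (simp add: powr_divide powr_diff)
    finally show ?thesis using Us by (simp add: mult_ac)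
  qed
  have "XX powr q / UU powr (q - 1) = UU * \<rho> powr q"
    using XX UU by (simp add: \<rho>_def powr_divide powr_diff)
  also have "\<dots> = q * \<rho> powr (q - 1) * XX - (q - 1) * \<rho> powr q * UU"
  proof (cases "XX = 0")
    case False
    then have "0 < \<rho>" using XX UU by (simp add: \<rho>_def)
    moreover have "XX = \<rho> * UU" using UU by (simp add: \<rho>_def)
    ultimately show ?thesis by (simp add: powr_diff field_simps)
  qed (simp add: \<rho>_def)
  also have "\<dots> = (\<Sum>s\<in>S. q * \<rho> powr (q - 1) * X s - (q - 1) * \<rho> powr q * U s)"
    by (simp add: XX_def UU_def sum_subtractf sum_distrib_left)
  also have "\<dots> \<le> (\<Sum>s\<in>S. X s powr q / U s powr (q - 1))"
    by (intro sum_mono pt)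
  finally show ?thesis by (simp add: XX_def UU_def)
qed simp

text \<open>Quantifies the decrease of the Bellman function when mass \<open>w\<close> joins the
  denominator. With \<open>m\<close> the volume of a cell, \<open>u + w \<le> 2 * m\<close>
  expresses the Carleson condition, and \<open>2 powr q\<close> arises from replacing
  \<open>u + w\<close> by \<open>2 * m\<close>.\<close>

lemma powr_perspective_decrease:
  fixes q u w m X :: real
  assumes "1 < q" "0 < u" "0 \<le> w" "u + w \<le> 2 * m" "0 \<le> X"
  shows "(q - 1) / 2 powr q * (w * (X / m) powr q)
         \<le> X powr q / u powr (q - 1) - X powr q / (u + w) powr (q - 1)"
proof -
  define v where "v = u + w"
  have v: "0 < v" "v \<le> 2 * m" "u \<le> v" using assms by (auto simp: v_def)
  have m: "0 < m" using v by simp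
  \<comment> \<open>The bounds \<open>ln x \<le> x - 1\<close> and \<open>1 + x \<le> exp x\<close>
    combine to a Bernoulli-type inequality valid for every \<open>q > 1\<close>, exponents
    \<open>q - 1\<close> below 1 included.\<close>
  have "ln (u / v) \<le> u / v - 1" using assms v by (intro ln_le_minus_one) simp
  then have "(q - 1) * (w / v) \<le> - (q - 1) * ln (u / v)"
    using assms v mult_left_mono[of "ln (u/v)" "u/v - 1" "q - 1"]
    by (simp add: v_def field_simps)
  also have "\<dots> \<le> (u / v) powr (- (q - 1)) - 1"
    using exp_ge_add_one_self[of "- (q - 1) * ln (u / v)"] assms v
    by (simp add: powr_def del: exp_ge_add_one_self)
  also have "(u / v) powr (- (q - 1)) = v powr (q - 1) / u powr (q - 1)"
    using assms v by (subst powr_minus) (simp add: powr_divide)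
  finally have 1: "(q - 1) * (w / v) \<le> v powr (q - 1) / u powr (q - 1) - 1" .
  have "(q - 1) * w / v powr q = (q - 1) * (w / v) / v powr (q - 1)"
    using v by (simp add: powr_diff)
  also have "\<dots> \<le> (v powr (q - 1) / u powr (q - 1) - 1) / v powr (q - 1)"
    using 1 by (intro divide_right_mono) auto
  also have "\<dots> = 1 / u powr (q - 1) - 1 / v powr (q - 1)"
    using v by (simp add: diff_divide_distrib)
  finally have 2: "(q - 1) * w / v powr q \<le> 1 / u powr (q - 1) - 1 / v powr (q - 1)" .
  have "v powr q \<le> (2 * m) powr q" using v assms by (intro powr_mono2) auto
  then have "(q - 1) * w / (2 * m) powr q \<le> (q - 1) * w / v powr q"
    using assms v m by (intro divide_left_mono mult_pos_pos mult_nonneg_nonneg) auto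
  with 2 have "(q - 1) * w / (2 * m) powr q \<le> 1 / u powr (q - 1) - 1 / v powr (q - 1)" by simp
  then have "X powr q * ((q - 1) * w / (2 * m) powr q)
      \<le> X powr q * (1 / u powr (q - 1) - 1 / v powr (q - 1))"
    by (rule mult_left_mono) simp
  moreover have "X powr q * ((q - 1) * w / (2 * m) powr q) = (q - 1) / 2 powr q * (w * (X / m) powr q)"
    using m assms by (simp add: powr_mult powr_divide)
  ultimately show ?thesis by (simp add: v_def right_diff_distrib)
qed

subsection \<open>Dyadic cells\<close>

text \<open>A cell is a pair \<open>(a, t)\<close> standing for the half-open cube with lower corner \<open>a\<close> and side
  \<open>2\<^sup>t\<close>; the exponent keeps every such pair nondegenerate.\<close>

type_synonym 'a cell = "'a \<times> real"

definition side :: "'a cell \<Rightarrow> real" where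
  "side c = 2 powr snd c"

definition cube_of :: "'a::euclidean_space cell \<Rightarrow> 'a set" where
  "cube_of c = {x. \<forall>b\<in>Basis. fst c \<bullet> b \<le> x \<bullet> b \<and> x \<bullet> b < fst c \<bullet> b + side c}"

text \<open>The subset \<open>A\<close> lists the coordinates in which the upper half is
  taken.\<close>

definition children :: "'a::euclidean_space cell \<Rightarrow> 'a cell set" where
  "children c = (\<lambda>A. (fst c + (side c / 2) *\<^sub>R \<Sum>A, snd c - 1)) ` Pow Basis"

primrec desc :: "nat \<Rightarrow> 'a::euclidean_space cell \<Rightarrow> 'a cell set" where
  "desc 0 c = {c}"
| "desc (Suc h) c = insert c (\<Union>s\<in>children c. desc h s)"

definition vol :: "'a::euclidean_space cell \<Rightarrow> real" where
  "vol c = side c ^ DIM('a)"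

lemma side_pos [simp]: "0 < side c"
  by (simp add: side_def)

lemma vol_pos [simp]: "0 < vol c"
  by (simp add: vol_def)

lemma vol_neq_0 [simp]: "vol c \<noteq> 0"
  using vol_pos[of c] by (metis less_irrefl)

lemma vol_nonneg [simp]: "0 \<le> vol c"
  by (simp add: less_imp_le)

lemma side_children: "s \<in> children c \<Longrightarrow> side s = side c / 2"
  by (auto simp: children_def side_def powr_diff)

lemma snd_children: "s \<in> children c \<Longrightarrow> snd s = snd c - 1"
  by (auto simp: children_def)

lemma vol_children:
  fixes c :: "'a::euclidean_space cell"
  shows "s \<in> children c \<Longrightarrow> vol c = 2 ^ DIM('a) * vol s"
  by (simp add: vol_def side_children power_divide)

lemma finite_children [simp]: "finite (children c)"
  by (simp add: children_def)

lemma finite_desc [simp]: "finite (desc h c)"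
  by (induction h arbitrary: c) auto

lemma inner_sum_Basis:
  assumes "A \<subseteq> Basis" "b \<in> Basis"
  shows "\<Sum>A \<bullet> b = (if b \<in> A then 1 else 0)"
proof -
  have "\<Sum>A \<bullet> b = (\<Sum>a\<in>A. if a = b then 1 else 0)"
    using assms by (auto simp: inner_sum_left inner_Basis intro!: sum.cong)
  also have "\<dots> = (if b \<in> A then 1 else 0)"
    using assms finite_subset[OF _ finite_Basis] by (subst sum.delta) auto
  finally show ?thesis .
qed

lemma cube_of_children: "cube_of c = (\<Union>s\<in>children c. cube_of s)"
proof (intro equalityI subsetI)
  fix x assume x: "x \<in> cube_of c"
  define A where "A = {b\<in>Basis. fst c \<bullet> b + side c / 2 \<le> x \<bullet> b}"
  have A: "A \<subseteq> Basis" by (auto simp: A_def)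
  let ?s = "(fst c + (side c / 2) *\<^sub>R \<Sum>A, snd c - 1)"
  have s: "?s \<in> children c" using A by (auto simp: children_def)
  have "x \<in> cube_of ?s"
    unfolding cube_of_def mem_Collect_eq side_children[OF s]
    using x A by (auto simp: inner_add_left inner_sum_Basis cube_of_def) (auto simp: A_def)
  with s show "x \<in> (\<Union>s\<in>children c. cube_of s)" by blast
next
  fix x assume "x \<in> (\<Union>s\<in>children c. cube_of s)"
  then obtain s where s: "s \<in> children c" and x: "x \<in> cube_of s" by blast
  then obtain A where A: "A \<subseteq> Basis" "s = (fst c + (side c / 2) *\<^sub>R \<Sum>A, snd c - 1)"
    by (auto simp: children_def)
  have pos: "0 < side c" by simp
  show "x \<in> cube_of c"
    unfolding cube_of_def
  proof (safe)
    fix b :: 'a assume b: "b \<in> Basis"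
    have "fst s \<bullet> b \<le> x \<bullet> b \<and> x \<bullet> b < fst s \<bullet> b + side c / 2"
      using x b side_children[OF s] by (auto simp: cube_of_def)
    moreover have "fst s \<bullet> b = fst c \<bullet> b + (if b \<in> A then side c / 2 else 0)"
      using A b by (simp add: inner_add_left inner_sum_Basis)
    ultimately show "fst c \<bullet> b \<le> x \<bullet> b" "x \<bullet> b < fst c \<bullet> b + side c"
      using pos by (auto split: if_splits)
  qed
qed

lemma disjoint_children: "disjoint_family_on cube_of (children c)"
  unfolding disjoint_family_on_def
proof (intro ballI impI)
  fix s t assume st: "s \<in> children c" "t \<in> children c" "s \<noteq> t"
  then obtain A B where A: "A \<subseteq> Basis" "s = (fst c + (side c / 2) *\<^sub>R \<Sum>A, snd c - 1)"
    and B: "B \<subseteq> Basis" "t = (fst c + (side c / 2) *\<^sub>R \<Sum>B, snd c - 1)"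
    by (auto simp: children_def)
  with st have "A \<noteq> B" by auto
  then obtain b where b: "b \<in> Basis" "(b \<in> A) \<noteq> (b \<in> B)" using A B by blast
  have "fst s \<bullet> b = fst c \<bullet> b + (if b \<in> A then side c / 2 else 0)"
       "fst t \<bullet> b = fst c \<bullet> b + (if b \<in> B then side c / 2 else 0)"
    using A B b by (simp_all add: inner_add_left inner_sum_Basis)
  with b side_children[OF st(1)] side_children[OF st(2)]
  have "\<not> (x \<in> cube_of s \<and> x \<in> cube_of t)" for x
    unfolding cube_of_def mem_Collect_eq by (smt (verit, best) field_sum_of_halves)
  then show "cube_of s \<inter> cube_of t = {}" by blast
qed

lemma corner_in_cube_of: "fst c \<in> cube_of c"
  by (auto simp: cube_of_def)

lemma children_subset: "s \<in> children c \<Longrightarrow> cube_of s \<subseteq> cube_of c"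
  using cube_of_children by blast

lemma desc_subset: "s \<in> desc h c \<Longrightarrow> cube_of s \<subseteq> cube_of c"
  by (induction h arbitrary: c) (auto dest!: children_subset)

lemma snd_desc: "s \<in> desc h c \<Longrightarrow> snd s \<le> snd c"
proof (induction h arbitrary: c)
  case (Suc h)
  then show ?case using snd_children[of _ c] by fastforce
qed simp

lemma self_in_desc [simp]: "c \<in> desc h c"
  by (cases h) auto

lemma desc_mono: "i \<le> h \<Longrightarrow> desc i c \<subseteq> desc h c"
proof (induction i arbitrary: h c)
  case (Suc i)
  then obtain h' where "h = Suc h'" "i \<le> h'" by (cases h) auto
  with Suc.IH show ?case by fastforce
qed auto

text \<open>Disjointness of the index sets is read off from geometry: a half-open cell contains its
  lower corner, so a cell common to two subtrees would place a point in two disjoint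
  children.\<close>

lemma sum_over_children:
  fixes \<phi> :: "'a::euclidean_space cell \<Rightarrow> real"
  assumes "\<And>s. s \<in> children c \<Longrightarrow> U s \<subseteq> desc h s"
  shows "sum \<phi> (\<Union>s\<in>children c. U s) = (\<Sum>s\<in>children c. sum \<phi> (U s))"
proof (rule sum.UNION_disjoint)
  show "\<forall>s\<in>children c. finite (U s)" using assms by (meson finite_desc finite_subset)
  show "\<forall>s\<in>children c. \<forall>t\<in>children c. s \<noteq> t \<longrightarrow> U s \<inter> U t = {}"
  proof (intro ballI impI)
    fix s t assume st: "s \<in> children c" "t \<in> children c" "s \<noteq> t"
    have "cube_of s \<inter> cube_of t = {}"
      using disjoint_children[of c] st unfolding disjoint_family_on_def by blast
    moreover have "fst x \<in> cube_of s" if "x \<in> U s" for x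
      using assms[OF st(1)] desc_subset corner_in_cube_of that by blast
    moreover have "fst x \<in> cube_of t" if "x \<in> U t" for x
      using assms[OF st(2)] desc_subset corner_in_cube_of that by blast
    ultimately show "U s \<inter> U t = {}" by blast
  qed
qed simp

lemma sum_insert_children:
  fixes \<phi> :: "'a::euclidean_space cell \<Rightarrow> real"
  assumes "\<And>s. s \<in> children c \<Longrightarrow> U s \<subseteq> desc h s"
  shows "sum \<phi> (insert c (\<Union>s\<in>children c. U s)) = \<phi> c + (\<Sum>s\<in>children c. sum \<phi> (U s))"
proof -
  have "c \<notin> U s" if "s \<in> children c" for s
  proof
    assume "c \<in> U s"
    then have "snd c \<le> snd s" using assms[OF that] snd_desc by blast
    then show False using snd_children[OF that] by simp
  qed
  then have "c \<notin> (\<Union>s\<in>children c. U s)" by blast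
  moreover have "finite (\<Union>s\<in>children c. U s)"
    using assms by (intro finite_UN_I finite_children) (meson finite_desc finite_subset)
  ultimately show ?thesis using sum_over_children[OF assms] by simp
qed

lemma sum_desc_Suc:
  fixes \<phi> :: "'a::euclidean_space cell \<Rightarrow> real"
  shows "sum \<phi> (desc (Suc h) c) = \<phi> c + (\<Sum>s\<in>children c. sum \<phi> (desc h s))"
  using sum_insert_children[of c "desc h" h \<phi>] by simp

section \<open>Measures of cells and additive cell functions\<close>

lemma cube_of_borel [measurable, simp]: "cube_of c \<in> sets borel"
  unfolding cube_of_def by measurable

lemma measure_cbox_side:
  fixes a :: "'a::euclidean_space"
  assumes "0 \<le> l" shows "measure lebesgue (cbox a (a + l *\<^sub>R One)) = l ^ DIM('a)"
  using assms by (subst measure_completion) (auto simp: content_cbox_if box_eq_empty inner_add_left)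

lemma cube_of_subset_cbox: "cube_of c \<subseteq> cbox (fst c) (fst c + side c *\<^sub>R One)"
  by (auto simp: cube_of_def mem_box inner_add_left less_imp_le)

lemma cube_of_lmeasurable [simp]: "cube_of c \<in> lmeasurable"
  by (rule bounded_set_imp_lmeasurable)
    (use cube_of_subset_cbox bounded_cbox bounded_subset in blast, simp)

lemma content_cube_of [simp]: "measure lborel (cube_of c) = vol (c :: 'a::euclidean_space cell)"
proof (rule antisym)
  show "measure lborel (cube_of c) \<le> vol c"
    using measure_mono_fmeasurable[OF cube_of_subset_cbox[of c], of lebesgue]
      measure_cbox_side[of "side c" "fst c"]
    by (simp add: vol_def less_imp_le)
  have "box (fst c) (fst c + side c *\<^sub>R One) \<subseteq> cube_of c"
    by (auto simp: cube_of_def mem_box inner_add_left less_imp_le)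
  then have "measure lebesgue (box (fst c) (fst c + side c *\<^sub>R One)) \<le> measure lebesgue (cube_of c)"
    by (intro measure_mono_fmeasurable) auto
  moreover have "measure lborel (box (fst c) (fst c + side c *\<^sub>R One)) = side c ^ DIM('a)"
    by (auto simp: measure_lborel_box_eq inner_add_left less_imp_le)
  ultimately show "vol c \<le> measure lborel (cube_of c)" by (simp add: vol_def)
qed

lemma measure_cube_of [simp]: "measure lebesgue (cube_of c) = vol c"
  by simp

text \<open>Isolates what the tree arguments use of an integral, so that integrals and the volume
  are treated alike.\<close>

definition additive :: "('a::euclidean_space cell \<Rightarrow> real) \<Rightarrow> bool" where
  "additive X \<longleftrightarrow> (\<forall>c. X c = (\<Sum>s\<in>children c. X s)) \<and> (\<forall>c. 0 \<le> X c)"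

lemma additive_integral:
  assumes "\<And>c. set_integrable lebesgue (cube_of c) f" "\<And>x. 0 \<le> f x"
  shows "additive (\<lambda>c. LINT x:cube_of c|lebesgue. f x)"
  unfolding additive_def
proof (intro conjI allI)
  fix c :: "'a cell"
  have "(LINT x:(\<Union>s\<in>children c. cube_of s)|lebesgue. f x) = (\<Sum>s\<in>children c. LINT x:cube_of s|lebesgue. f x)"
    by (intro set_integral_finite_Union disjoint_children assms(1)) (simp_all add: fmeasurableD)
  then show "(LINT x:cube_of c|lebesgue. f x) = (\<Sum>s\<in>children c. LINT x:cube_of s|lebesgue. f x)"
    by (simp flip: cube_of_children)
  show "0 \<le> (LINT x:cube_of c|lebesgue. f x)"
    unfolding set_lebesgue_integral_def
    using assms(2) by (intro Bochner_Integration.integral_nonneg) auto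
qed

lemma additive_nonneg: "additive X \<Longrightarrow> 0 \<le> X c"
  unfolding additive_def by blast

lemma additive_children: "additive X \<Longrightarrow> X c = (\<Sum>s\<in>children c. X s)"
  unfolding additive_def by blast

lemma additive_vol: "additive (vol :: 'a::euclidean_space cell \<Rightarrow> real)"
proof -
  have "integrable lebesgue (indicat_real (cube_of c))" for c :: "'a cell"
    using cube_of_lmeasurable[of c] by (simp add: fmeasurable_def del: cube_of_lmeasurable)
  then show ?thesis
    using additive_integral[of "\<lambda>_::'a. 1 :: real"]
    by (simp add: set_integrable_def set_lebesgue_integral_def)
qed

lemma additive_child_le: "additive X \<Longrightarrow> s \<in> children c \<Longrightarrow> X s \<le> X c"
  by (subst additive_children, assumption) (auto intro!: member_le_sum additive_nonneg)

lemma additive_desc_le: "additive X \<Longrightarrow> s \<in> desc h c \<Longrightarrow> X s \<le> X c"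
proof (induction h arbitrary: c)
  case (Suc h)
  then show ?case
    using additive_child_le[OF Suc.prems(1), of _ c] by fastforce
qed simp

subsection \<open>The Carleson embedding theorem\<close>

text \<open>Meant for a cell that is not bad: \<open>x j\<close> is the average for one component,
  \<open>A j\<close> the reference average and \<open>e j = 1 / r j\<close>, so
  \<open>1 / (e j * p j) = r j / p j\<close>. Indices with \<open>e j > 0\<close> go through the
  arithmetic-geometric mean inequality; those with \<open>e j = 0\<close> offer only the bound
  \<open>K * A j\<close>, and \<open>K ^ (n + 1)\<close> covers all of these factors, whatever their
  number.\<close>

lemma prod_powr_le_sum:
  fixes x A e p :: "nat \<Rightarrow> real"
  assumes p: "\<And>j. j \<le> n \<Longrightarrow> 1 \<le> p j" and e: "\<And>j. j \<le> n \<Longrightarrow> 0 \<le> e j"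
    and sum_e: "(\<Sum>j\<le>n. e j) = 1" and K: "1 \<le> K"
    and A: "\<And>j. j \<le> n \<Longrightarrow> 0 < A j" and x: "\<And>j. j \<le> n \<Longrightarrow> 0 \<le> x j"
    and x_le: "\<And>j. j \<le> n \<Longrightarrow> e j = 0 \<Longrightarrow> x j \<le> K * A j"
  shows "(\<Prod>j\<le>n. x j powr (1 / p j))
    \<le> (\<Prod>j\<le>n. A j powr (1 / p j)) * K ^ (n + 1)
        * (\<Sum>j\<in>{j. j \<le> n \<and> 0 < e j}. (x j / A j) powr (1 / (e j * p j)))"
proof -
  define J where "J = {j. j \<le> n \<and> 0 < e j}"
  define y where "y j = (x j / A j) powr (1 / p j)" for j
  define z where "z j = (x j / A j) powr (1 / (e j * p j))" for j
  have J: "J \<subseteq> {..n}" "finite J" by (auto simp: J_def)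
  have y_J: "y j = z j powr e j" if "j \<in> J" for j
  proof -
    have "1 / (e j * p j) * e j = 1 / p j" using that by (simp add: J_def)
    then show ?thesis unfolding y_def z_def powr_powr by (simp only:)
  qed
  have "(\<Sum>j\<in>J. e j) = 1"
  proof -
    have "e j = 0" if "j \<in> {..n} - J" for j
      using that e[of j] by (simp add: J_def)
    then show ?thesis
      using sum_e sum.mono_neutral_left[OF _ J(1), of e] by simp
  qed
  then have "(\<Prod>j\<in>J. z j powr e j) \<le> (\<Sum>j\<in>J. e j * z j)"
    using J by (intro weighted_arith_geom_mean) (auto simp: J_def z_def)
  also have "\<dots> \<le> (\<Sum>j\<in>J. z j)"
  proof (rule sum_mono)
    fix j assume j: "j \<in> J"
    then have "e j \<le> (\<Sum>j\<le>n. e j)" using J e by (intro member_le_sum) auto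
    then show "e j * z j \<le> z j" using sum_e by (intro mult_left_le_one_le) (use j in \<open>auto simp: J_def z_def\<close>)
  qed
  finally have prod_J: "(\<Prod>j\<in>J. y j) \<le> (\<Sum>j\<in>J. z j)" using y_J by simp
  have y_le: "y j \<le> K" if "j \<in> {..n} - J" for j
  proof -
    have j: "j \<le> n" "e j = 0" using that e[of j] by (auto simp: J_def)
    then have "y j \<le> K powr (1 / p j)"
      unfolding y_def using A[of j] x[of j] x_le[of j] p[of j]
      by (intro powr_mono2) (auto simp: field_simps)
    also have "\<dots> \<le> K powr 1" using K p[OF j(1)] by (intro powr_mono) auto
    finally show ?thesis using K by simp
  qed
  have "(\<Prod>j\<in>{..n} - J. y j) \<le> (\<Prod>j\<in>{..n} - J. K)"
    using y_le by (intro prod_mono) (auto simp: y_def)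
  also have "\<dots> \<le> K ^ (n + 1)"
    using K card_mono[of "{..n}" "{..n} - J"] power_increasing[of "card ({..n} - J)" "n + 1" K] by simp
  finally have prod_nJ: "(\<Prod>j\<in>{..n} - J. y j) \<le> K ^ (n + 1)" .
  have "(\<Prod>j\<le>n. x j powr (1 / p j)) = (\<Prod>j\<le>n. A j powr (1 / p j) * y j)"
  proof (rule prod.cong)
    fix j assume "j \<in> {..n}"
    then show "x j powr (1 / p j) = A j powr (1 / p j) * y j"
      using A[of j] x[of j] by (simp add: y_def powr_divide)
  qed simp
  also have "\<dots> = (\<Prod>j\<le>n. A j powr (1 / p j)) * ((\<Prod>j\<in>{..n} - J. y j) * (\<Prod>j\<in>J. y j))"
    using J by (simp add: prod.distrib prod.subset_diff[of J "{..n}" y])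
  also have "\<dots> \<le> (\<Prod>j\<le>n. A j powr (1 / p j)) * (K ^ (n + 1) * (\<Sum>j\<in>J. z j))"
    using prod_J prod_nJ K by (intro mult_left_mono mult_mono prod_nonneg) (auto simp: y_def)
  finally show ?thesis by (simp add: J_def z_def mult.assoc)
qed

text \<open>With \<open>bad\<close> as stopping rule, \<open>upper\<close> keeps the cells that are
  not bad and have no bad ancestor in the tree. The sets \<open>leaves\<close> below consist of the
  maximal bad cells and the bottom cells of branches that never stop; they tile \<open>c\<close>. A
  bottom cell that is not bad lies in both.\<close>

primrec upper :: "('a::euclidean_space cell \<Rightarrow> bool) \<Rightarrow> nat \<Rightarrow> 'a cell \<Rightarrow> 'a cell set" where
  "upper bad 0 c = (if bad c then {} else {c})"
| "upper bad (Suc h) c = (if bad c then {} else insert c (\<Union>s\<in>children c. upper bad h s))"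

primrec leaves :: "('a::euclidean_space cell \<Rightarrow> bool) \<Rightarrow> nat \<Rightarrow> 'a cell \<Rightarrow> 'a cell set" where
  "leaves bad 0 c = {c}"
| "leaves bad (Suc h) c = (if bad c then {c} else (\<Union>s\<in>children c. leaves bad h s))"

lemma upper_subset_desc: "upper bad h c \<subseteq> desc h c"
  by (induction h arbitrary: c) auto

lemma leaves_subset_desc: "leaves bad h c \<subseteq> desc h c"
  by (induction h arbitrary: c) auto

lemma upper_not_bad: "R \<in> upper bad h c \<Longrightarrow> \<not> bad R"
  by (induction h arbitrary: c) (auto split: if_splits)

lemma upper_bad: "bad c \<Longrightarrow> upper bad h c = {}"
  by (cases h) auto

lemma sum_upper_Suc:
  fixes \<phi> :: "'a::euclidean_space cell \<Rightarrow> real"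
  shows "\<not> bad c \<Longrightarrow> sum \<phi> (upper bad (Suc h) c) = \<phi> c + (\<Sum>s\<in>children c. sum \<phi> (upper bad h s))"
  using sum_insert_children[of c "upper bad h" h \<phi>, OF upper_subset_desc] by simp

lemma sum_leaves_Suc:
  fixes \<phi> :: "'a::euclidean_space cell \<Rightarrow> real"
  shows "\<not> bad c \<Longrightarrow> sum \<phi> (leaves bad (Suc h) c) = (\<Sum>s\<in>children c. sum \<phi> (leaves bad h s))"
  using sum_over_children[of c "leaves bad h" h \<phi>, OF leaves_subset_desc] by simp

lemma sum_leaves_additive:
  assumes "additive X" shows "sum X (leaves bad h c) = X c"
proof (induction h arbitrary: c)
  case (Suc h)
  show ?case
  proof (cases "bad c")
    case False
    show ?thesis
      unfolding sum_leaves_Suc[of bad, OF False] Suc.IH by (rule additive_children[OF assms, symmetric])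
  qed simp
qed simp

text \<open>Induction on the depth with the Bellman function \<open>x\<^sup>q / (1 + M)\<^sup>q\<^sup>-\<^sup>1\<close>, where \<open>x\<close> is the average of
  \<open>X\<close> and \<open>M\<close> the normalised Carleson sum over the cell.\<close>

lemma carleson_embedding:
  fixes X w :: "'a::euclidean_space cell \<Rightarrow> real"
  assumes X: "additive X" and q: "1 < q" and w: "\<And>c. 0 \<le> w c"
    and carleson: "\<And>h c. sum w (desc h c) \<le> vol c"
  shows "(q - 1) / 2 powr q * (\<Sum>R\<in>upper bad h c. w R * (X R / vol R) powr q)
    \<le> (\<Sum>R\<in>leaves bad h c. vol R * (X R / vol R) powr q)
      - X c powr q / (vol c + sum w (desc h c)) powr (q - 1)"
proof (induction h arbitrary: c)
  \<comment> \<open>At a leaf the Bellman function is at most its value for \<open>M = 0\<close>,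
    which is the contribution of the leaf.\<close>
  have lf: "X c powr q / (vol c + M) powr (q - 1) \<le> vol c * (X c / vol c) powr q"
    if "0 \<le> M" for M and c :: "'a cell"
  proof -
    have "X c powr q / (vol c + M) powr (q - 1) \<le> X c powr q / vol c powr (q - 1)"
      using that q vol_pos[of c]
      by (intro divide_left_mono powr_mono2 mult_pos_pos) (auto simp: add_pos_nonneg simp del: vol_pos)
    also have "\<dots> = vol c * (X c / vol c) powr q"
      using additive_nonneg[OF X, of c] by (simp add: powr_divide powr_diff less_imp_le)
    finally show ?thesis .
  qed
  {
    case 0
    show ?case
    proof (cases "bad c")
      case True
      then show ?thesis using lf[of "w c" c] w by simp
    next
      case False
      have "(q - 1) / 2 powr q * (w c * (X c / vol c) powr q)
         \<le> X c powr q / vol c powr (q - 1) - X c powr q / (vol c + w c) powr (q - 1)"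
        using carleson[of 0 c] w q additive_nonneg[OF X] by (intro powr_perspective_decrease) auto
      also have "X c powr q / vol c powr (q - 1) = vol c * (X c / vol c) powr q"
        using additive_nonneg[OF X, of c] by (simp add: powr_divide powr_diff less_imp_le)
      finally show ?thesis using False by simp
    qed
  next
    case (Suc h)
    show ?case
    proof (cases "bad c")
      case True
      have "0 \<le> sum w (desc (Suc h) c)" by (intro sum_nonneg w)
      with lf[OF this, of c] True show ?thesis by (simp del: desc.simps)
    next
      case False
      \<comment> \<open>The denominator before the weight of the root is added. Subadditivity
        compares the children with the parent at \<open>u\<close>; adding \<open>w c\<close> then
        releases the decrease that pays for the term of the root.\<close>
      define u where "u = vol c + (\<Sum>s\<in>children c. sum w (desc h s))"
      have nn: "0 \<le> sum w (desc h s)" for s by (intro sum_nonneg w)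
      have U: "u + w c = vol c + sum w (desc (Suc h) c)"
        by (simp add: u_def sum_desc_Suc del: desc.simps)
      have u_pos: "0 < u" unfolding u_def by (intro add_pos_nonneg sum_nonneg nn) auto
      let ?\<kappa> = "(q - 1) / 2 powr q"
      let ?\<phi> = "\<lambda>R. w R * (X R / vol R) powr q"
      let ?\<psi> = "\<lambda>R. vol R * (X R / vol R) powr q"
      have "(\<Sum>s\<in>children c. ?\<kappa> * sum ?\<phi> (upper bad h s))
        \<le> (\<Sum>s\<in>children c. sum ?\<psi> (leaves bad h s) - X s powr q / (vol s + sum w (desc h s)) powr (q - 1))"
        by (intro sum_mono Suc.IH)
      then have "?\<kappa> * (\<Sum>s\<in>children c. sum ?\<phi> (upper bad h s)) \<le> sum ?\<psi> (leaves bad (Suc h) c)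
          - (\<Sum>s\<in>children c. X s powr q / (vol s + sum w (desc h s)) powr (q - 1))"
        by (simp only: sum_leaves_Suc[of bad, OF False] sum_subtractf sum_distrib_left)
      moreover have "X c powr q / u powr (q - 1)
        \<le> (\<Sum>s\<in>children c. X s powr q / (vol s + sum w (desc h s)) powr (q - 1))"
        using sum_powr_perspective_le[of "children c" q X "\<lambda>s. vol s + sum w (desc h s)"] q nn
        by (simp add: u_def additive_nonneg[OF X] add_pos_nonneg sum.distrib
            flip: additive_children[OF X, of c] additive_children[OF additive_vol, of c])
      moreover have "?\<kappa> * ?\<phi> c \<le> X c powr q / u powr (q - 1) - X c powr q / (u + w c) powr (q - 1)"
        using q u_pos w U carleson[of "Suc h" c]
        by (intro powr_perspective_decrease additive_nonneg[OF X]) auto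
      ultimately show ?thesis
        unfolding U sum_upper_Suc[of bad, OF False] distrib_left by linarith
    qed
  }
qed

text \<open>A leaf below the root has a parent that is not bad, and passing to a child divides the
  volume by \<open>2 ^ d\<close>. A root that is itself a leaf has no such parent, whence the
  separate premise on \<open>c\<close>.\<close>

lemma leaves_average_le:
  fixes c :: "'a::euclidean_space cell"
  assumes B: "additive B" and L: "0 \<le> L" and bad: "\<And>c. \<not> bad c \<Longrightarrow> B c \<le> L * vol c"
  shows "B c \<le> 2 ^ DIM('a) * L * vol c \<Longrightarrow> R \<in> leaves bad h c \<Longrightarrow> B R \<le> 2 ^ DIM('a) * L * vol R"
proof (induction h arbitrary: c)
  case (Suc h)
  show ?case
  proof (cases "bad c")
    case False
    with Suc.prems obtain s where s: "s \<in> children c" "R \<in> leaves bad h s" by auto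
    have "B s \<le> B c" using additive_child_le[OF B s(1)] .
    also have "\<dots> \<le> L * (2 ^ DIM('a) * vol s)" using bad[OF False] vol_children[OF s(1)] by simp
    finally show ?thesis using Suc.IH[OF _ s(2)] by (simp add: mult_ac)
  qed (use Suc.prems in auto)
qed auto

text \<open>The embedding is applied to each \<open>k\<close> separately, and the sum over
  \<open>k\<close> is evaluated only on the leaves: there \<open>minkowski\<close> replaces it by
  \<open>B\<close>, whose averages are bounded, and the leaves tile \<open>c\<close>. No factor
  depending on \<open>N\<close> appears.\<close>

lemma vector_carleson_embedding:
  fixes c :: "'a::euclidean_space cell" and w X :: "nat \<Rightarrow> 'a cell \<Rightarrow> real"
  assumes X: "\<And>k. k < N \<Longrightarrow> additive (X k)" and B: "additive B" and q: "1 < q"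
    and w: "\<And>k c. k < N \<Longrightarrow> 0 \<le> w k c"
    and carleson: "\<And>k h c. k < N \<Longrightarrow> sum (w k) (desc h c) \<le> vol c"
    and minkowski: "\<And>c. (\<Sum>k<N. X k c powr q) \<le> B c powr q"
    and L: "0 \<le> L" and bad: "\<And>c. \<not> bad c \<Longrightarrow> B c \<le> L * vol c"
    and c: "B c \<le> 2 ^ DIM('a) * L * vol c"
  shows "(\<Sum>R\<in>upper bad h c. \<Sum>k<N. w k R * (X k R / vol R) powr q)
    \<le> 2 powr q / (q - 1) * ((2 ^ DIM('a) * L) powr q * vol c)"
proof -
  let ?\<kappa> = "(q - 1) / 2 powr q"
  have "?\<kappa> * (\<Sum>R\<in>upper bad h c. \<Sum>k<N. w k R * (X k R / vol R) powr q)
    = (\<Sum>k<N. ?\<kappa> * (\<Sum>R\<in>upper bad h c. w k R * (X k R / vol R) powr q))"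
    by (subst sum.swap) (simp add: sum_distrib_left)
  also have "\<dots> \<le> (\<Sum>k<N. \<Sum>R\<in>leaves bad h c. vol R * (X k R / vol R) powr q)"
  proof (rule sum_mono)
    fix k assume "k \<in> {..<N}"
    then have k: "k < N" by simp
    have "0 \<le> X k c powr q / (vol c + sum (w k) (desc h c)) powr (q - 1)" by simp
    then show "?\<kappa> * (\<Sum>R\<in>upper bad h c. w k R * (X k R / vol R) powr q)
        \<le> (\<Sum>R\<in>leaves bad h c. vol R * (X k R / vol R) powr q)"
      using carleson_embedding[OF X[OF k] q w[OF k] carleson[OF k], of bad h c] by linarith
  qed
  also have "\<dots> = (\<Sum>R\<in>leaves bad h c. vol R * ((\<Sum>k<N. X k R powr q) / vol R powr q))"
    by (subst sum.swap) (auto simp: powr_divide sum_distrib_left sum_divide_distrib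
        additive_nonneg[OF X] less_imp_le intro!: sum.cong)
  also have "\<dots> \<le> (\<Sum>R\<in>leaves bad h c. vol R * (2 ^ DIM('a) * L) powr q)"
  proof (rule sum_mono, rule mult_left_mono)
    fix R assume R: "R \<in> leaves bad h c"
    have "(\<Sum>k<N. X k R powr q) \<le> (2 ^ DIM('a) * L * vol R) powr q"
      using leaves_average_le[OF B L bad c R] q
      by (intro order_trans[OF minkowski] powr_mono2 additive_nonneg[OF B]) auto
    also have "\<dots> = (2 ^ DIM('a) * L) powr q * vol R powr q"
      using L by (simp add: powr_mult less_imp_le)
    finally show "(\<Sum>k<N. X k R powr q) / vol R powr q \<le> (2 ^ DIM('a) * L) powr q"
      by (simp add: divide_le_eq)
  qed (simp add: less_imp_le)
  also have "\<dots> = (2 ^ DIM('a) * L) powr q * vol c"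
    using sum_leaves_additive[OF additive_vol, of bad h c] by (simp flip: sum_distrib_right)
  finally show ?thesis using q by (simp add: field_simps)
qed

subsection \<open>Stopping cubes\<close>

text \<open>The witness sets travel with the cells and are confined to \<open>V\<close>, so that
  families over disjoint regions can be united without a new choice of witnesses.\<close>

definition sparse_within :: "'a::euclidean_space set \<Rightarrow> ('a cell \<times> 'a set) set \<Rightarrow> bool" where
  "sparse_within V S \<longleftrightarrow> finite S \<and> disjoint_family_on snd S \<and>
     (\<forall>(Q, E)\<in>S. E \<in> sets lebesgue \<and> E \<subseteq> cube_of Q \<and> E \<subseteq> V \<and> vol Q / 2 < measure lebesgue E)"

lemma sparse_within_empty [simp]: "sparse_within V {}"
  by (simp add: sparse_within_def disjoint_family_on_def)

lemma sparse_within_mono: "sparse_within V S \<Longrightarrow> V \<subseteq> W \<Longrightarrow> sparse_within W S"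
  unfolding sparse_within_def by blast

lemma sparse_within_memD:
  assumes "sparse_within V S" "x \<in> S"
  shows "snd x \<in> sets lebesgue" "snd x \<subseteq> cube_of (fst x)" "snd x \<subseteq> V"
    "vol (fst x) / 2 < measure lebesgue (snd x)"
proof -
  have "case x of (Q, E) \<Rightarrow> E \<in> sets lebesgue \<and> E \<subseteq> cube_of Q \<and> E \<subseteq> V \<and> vol Q / 2 < measure lebesgue E"
    using assms unfolding sparse_within_def by blast
  then show "snd x \<in> sets lebesgue" "snd x \<subseteq> cube_of (fst x)" "snd x \<subseteq> V"
    "vol (fst x) / 2 < measure lebesgue (snd x)"
    by (simp_all add: split_beta)
qed

lemma sparse_within_nonempty:
  assumes "sparse_within V S" "x \<in> S" shows "snd x \<noteq> {}"
proof
  assume "snd x = {}"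
  then show False using sparse_within_memD(4)[OF assms] vol_pos[of "fst x"] by simp
qed

text \<open>The sum splits because the families are disjoint: a common pair would carry a nonempty
  witness set inside two disjoint regions.\<close>

lemma sparse_within_UN:
  assumes I: "finite I" "disjoint_family_on V I" and S: "\<And>i. i \<in> I \<Longrightarrow> sparse_within (V i) (S i)"
  shows "sparse_within (\<Union>i\<in>I. V i) (\<Union>i\<in>I. S i)"
    and "sum \<phi> (\<Union>i\<in>I. S i) = (\<Sum>i\<in>I. sum (\<phi> :: _ \<Rightarrow> real) (S i))"
proof -
  have disj: "snd x \<inter> snd y = {}" if "i \<in> I" "j \<in> I" "i \<noteq> j" "x \<in> S i" "y \<in> S j" for i j x y
    using sparse_within_memD(3)[OF S that(4)] sparse_within_memD(3)[OF S that(5)] I(2) that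
    unfolding disjoint_family_on_def by blast
  show "sparse_within (\<Union>i\<in>I. V i) (\<Union>i\<in>I. S i)"
    unfolding sparse_within_def
  proof (intro conjI)
    show "finite (\<Union>i\<in>I. S i)" using I(1) S unfolding sparse_within_def by blast
    show "disjoint_family_on snd (\<Union>i\<in>I. S i)"
      unfolding disjoint_family_on_def
    proof (intro ballI impI)
      fix x y assume "x \<in> (\<Union>i\<in>I. S i)" "y \<in> (\<Union>i\<in>I. S i)" "x \<noteq> y"
      then obtain i j where ij: "i \<in> I" "j \<in> I" "x \<in> S i" "y \<in> S j" by blast
      show "snd x \<inter> snd y = {}"
      proof (cases "i = j")
        case True
        with ij S[of i] \<open>x \<noteq> y\<close> show ?thesis unfolding sparse_within_def disjoint_family_on_def by blast
      qed (use disj ij in blast)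
    qed
    show "\<forall>(Q, E)\<in>\<Union>i\<in>I. S i. E \<in> sets lebesgue \<and> E \<subseteq> cube_of Q \<and> E \<subseteq> (\<Union>i\<in>I. V i)
        \<and> vol Q / 2 < measure lebesgue E"
    proof
      fix x assume "x \<in> (\<Union>i\<in>I. S i)"
      then obtain i where i: "i \<in> I" "x \<in> S i" by blast
      then have "V i \<subseteq> (\<Union>i\<in>I. V i)" by blast
      with sparse_within_memD[OF S[OF i(1)] i(2)]
      show "case x of (Q, E) \<Rightarrow> E \<in> sets lebesgue \<and> E \<subseteq> cube_of Q \<and> E \<subseteq> (\<Union>i\<in>I. V i)
          \<and> vol Q / 2 < measure lebesgue E"
        unfolding split_beta by blast
    qed
  qed
  show "sum \<phi> (\<Union>i\<in>I. S i) = (\<Sum>i\<in>I. sum \<phi> (S i))"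
  proof (rule sum.UNION_disjoint)
    show "\<forall>i\<in>I. finite (S i)" using S unfolding sparse_within_def by blast
    show "\<forall>i\<in>I. \<forall>j\<in>I. i \<noteq> j \<longrightarrow> S i \<inter> S j = {}"
    proof (intro ballI impI)
      fix i j assume ij: "i \<in> I" "j \<in> I" "i \<noteq> j"
      show "S i \<inter> S j = {}"
      proof (rule ccontr)
        assume "S i \<inter> S j \<noteq> {}"
        then obtain x where x: "x \<in> S i" "x \<in> S j" by blast
        then show False using disj[OF ij x] sparse_within_nonempty[OF S[OF ij(1)] x(1)] by simp
      qed
    qed
  qed (rule I)
qed

text \<open>Each of the \<open>n + 1\<close> stopping conditions may capture at most the fraction
  \<open>1 / (4 * (n + 1))\<close> of the root, so the stopping cells cover at most a quarter and
  more than half remains.\<close>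

definition stopping_ratio :: "nat \<Rightarrow> real" where
  "stopping_ratio n = 4 * real (n + 1)"

text \<open>The power of the stopping ratio comes from the product estimate. Each summand is the
  embedding constant \<open>2 powr q / (q - 1)\<close> for \<open>q = 1 / (e j * p j)\<close>, times
  the \<open>q\<close>-th power of the bound on normalised leaf averages.\<close>

definition sparse_const :: "nat \<Rightarrow> (nat \<Rightarrow> real) \<Rightarrow> (nat \<Rightarrow> real) \<Rightarrow> nat \<Rightarrow> real" where
  "sparse_const n p e d = stopping_ratio n ^ (n + 1) *
     (\<Sum>j\<in>{j. j \<le> n \<and> 0 < e j}. 2 powr (1 / (e j * p j)) / (1 / (e j * p j) - 1)
        * (2 ^ d * stopping_ratio n) powr (1 / (e j * p j)))"

text \<open>Intended reading: \<open>e j\<close> is \<open>1 / r j\<close>, \<open>X j k\<close>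
  integrates the \<open>p j\<close>-th power of one component, \<open>B j\<close> that of the
  \<open>r j\<close>-norm, and \<open>w k\<close> is the Carleson weight left by the sparse
  collection of \<open>T k\<close>. For infinite \<open>r j\<close> only \<open>X_le_B\<close> links
  the two integrals.\<close>

locale dyadic_data =
  fixes n N :: nat and p e :: "nat \<Rightarrow> real"
    and w :: "nat \<Rightarrow> 'a::euclidean_space cell \<Rightarrow> real"
    and X :: "nat \<Rightarrow> nat \<Rightarrow> 'a cell \<Rightarrow> real" and B :: "nat \<Rightarrow> 'a cell \<Rightarrow> real"
  assumes p: "\<And>j. j \<le> n \<Longrightarrow> 1 \<le> p j"
    and e: "\<And>j. j \<le> n \<Longrightarrow> 0 \<le> e j" and ep: "\<And>j. j \<le> n \<Longrightarrow> e j * p j < 1"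
    and sum_e: "(\<Sum>j\<le>n. e j) = 1"
    and X: "\<And>j k. j \<le> n \<Longrightarrow> k < N \<Longrightarrow> additive (X j k)"
    and B: "\<And>j. j \<le> n \<Longrightarrow> additive (B j)"
    and w: "\<And>k c. k < N \<Longrightarrow> 0 \<le> w k c"
    and carleson: "\<And>k h c. k < N \<Longrightarrow> sum (w k) (desc h c) \<le> vol c"
    and X_le_B: "\<And>j k c. j \<le> n \<Longrightarrow> k < N \<Longrightarrow> X j k c \<le> B j c"
    and minkowski: "\<And>j c. j \<le> n \<Longrightarrow> 0 < e j \<Longrightarrow>
          (\<Sum>k<N. X j k c powr (1 / (e j * p j))) \<le> B j c powr (1 / (e j * p j))"
begin

definition form :: "'a cell \<Rightarrow> real" where
  "form c = (\<Sum>k<N. w k c * (\<Prod>j\<le>n. (X j k c / vol c) powr (1 / p j)))"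

definition val :: "'a cell \<Rightarrow> real" where
  "val c = vol c * (\<Prod>j\<le>n. (B j c / vol c) powr (1 / p j))"

abbreviation "K \<equiv> stopping_ratio n"

lemma K_ge_1: "1 \<le> K"
  by (simp add: stopping_ratio_def)

lemma exponent_gt_1: "j \<le> n \<Longrightarrow> 0 < e j \<Longrightarrow> 1 < 1 / (e j * p j)"
  using p[of j] ep[of j] by (simp add: less_divide_eq)

lemma C0_nonneg: "0 \<le> sparse_const n p e DIM('a)"
  unfolding sparse_const_def using K_ge_1 exponent_gt_1
  by (intro mult_nonneg_nonneg sum_nonneg divide_nonneg_nonneg) (auto simp: less_imp_le)

definition bad :: "'a cell \<Rightarrow> 'a cell \<Rightarrow> bool" where
  "bad c0 c \<longleftrightarrow> (\<exists>j\<le>n. K * (B j c0 / vol c0) * vol c < B j c)"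

text \<open>On the cells of \<open>upper\<close> every average is at most \<open>K\<close> times
  that on the root, so the product estimate holds cell by cell. After division by
  \<open>A j\<close>, each index \<open>j\<close> with \<open>e j > 0\<close> is an instance of the
  vector embedding at level \<open>K * A j\<close>.\<close>

lemma form_upper_le:
  assumes A: "\<And>j. j \<le> n \<Longrightarrow> 0 < B j c"
  shows "sum form (upper (bad c) h c) \<le> sparse_const n p e DIM('a) * val c"
proof -
  define A where "A j = B j c / vol c" for j
  define q where "q j = 1 / (e j * p j)" for j
  define J where "J = {j. j \<le> n \<and> 0 < e j}"
  define P where "P = (\<Prod>j\<le>n. A j powr (1 / p j))"
  have A_pos: "0 < A j" if "j \<le> n" for j using A[OF that] by (simp add: A_def)
  have P: "0 \<le> P" unfolding P_def by (intro prod_nonneg) auto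
  have "form R \<le> P * K ^ (n + 1) * (\<Sum>j\<in>J. \<Sum>k<N. w k R * (X j k R / vol R / A j) powr q j)"
    if R: "R \<in> upper (bad c) h c" for R
  proof -
    have X_le: "X j k R / vol R \<le> K * A j" if "j \<le> n" "k < N" for j k
    proof -
      have "B j R \<le> K * A j * vol R"
        using upper_not_bad[OF R] that unfolding bad_def A_def by force
      then have "X j k R \<le> K * A j * vol R" using X_le_B[OF that, of R] by linarith
      then show ?thesis by (simp add: divide_le_eq)
    qed
    have "form R \<le> (\<Sum>k<N. w k R * (P * K ^ (n + 1) * (\<Sum>j\<in>J. (X j k R / vol R / A j) powr q j)))"
      unfolding form_def P_def J_def q_def
      by (intro sum_mono mult_left_mono prod_powr_le_sum p e sum_e K_ge_1 A_pos X_le w)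
        (auto intro!: divide_nonneg_pos additive_nonneg[OF X])
    also have "\<dots> = P * K ^ (n + 1) * (\<Sum>j\<in>J. \<Sum>k<N. w k R * (X j k R / vol R / A j) powr q j)"
      unfolding sum_distrib_left by (subst sum.swap) (simp add: mult_ac)
    finally show ?thesis .
  qed
  then have "sum form (upper (bad c) h c)
    \<le> (\<Sum>R\<in>upper (bad c) h c. P * K ^ (n + 1) * (\<Sum>j\<in>J. \<Sum>k<N. w k R * (X j k R / vol R / A j) powr q j))"
    by (rule sum_mono)
  also have "\<dots> = P * K ^ (n + 1) *
      (\<Sum>j\<in>J. \<Sum>R\<in>upper (bad c) h c. \<Sum>k<N. w k R * (X j k R / vol R / A j) powr q j)"
    unfolding sum_distrib_left by (subst sum.swap) simp
  also have "\<dots> \<le> P * K ^ (n + 1) *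
      (\<Sum>j\<in>J. 2 powr q j / (q j - 1) * ((2 ^ DIM('a) * K) powr q j * vol c))"
  proof (intro mult_left_mono sum_mono)
    fix j assume "j \<in> J"
    then have j: "j \<le> n" "0 < e j" by (auto simp: J_def)
    have q: "1 < q j" using exponent_gt_1[OF j] by (simp add: q_def)
    have L: "0 \<le> K * A j" using K_ge_1 A_pos[OF j(1)] by simp
    have one: "1 \<le> 2 ^ DIM('a) * K"
      using K_ge_1 mult_mono[of 1 "2 ^ DIM('a)" 1 K] by simp
    have bound: "(\<Sum>R\<in>upper (bad c) h c. \<Sum>k<N. w k R * (X j k R / vol R) powr q j)
      \<le> 2 powr q j / (q j - 1) * ((2 ^ DIM('a) * (K * A j)) powr q j * vol c)"
    proof (rule vector_carleson_embedding[OF X[OF j(1)] B[OF j(1)] q w carleson _ L])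
      show "(\<Sum>k<N. X j k c powr q j) \<le> B j c powr q j" for c
        using minkowski[OF j] by (simp add: q_def)
      show "B j c' \<le> K * A j * vol c'" if "\<not> bad c c'" for c'
        using that j unfolding bad_def A_def by force
      have "A j * vol c \<le> 2 ^ DIM('a) * K * (A j * vol c)"
        using mult_right_mono[OF one, of "A j * vol c"] A_pos[OF j(1)] vol_pos[of c]
        by (simp add: less_imp_le del: vol_pos)
      then show "B j c \<le> 2 ^ DIM('a) * (K * A j) * vol c"
        by (simp add: A_def mult_ac)
    qed auto
    have "(\<Sum>R\<in>upper (bad c) h c. \<Sum>k<N. w k R * (X j k R / vol R / A j) powr q j)
      = (\<Sum>R\<in>upper (bad c) h c. \<Sum>k<N. w k R * (X j k R / vol R) powr q j) / A j powr q j"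
      unfolding sum_divide_distrib
      using A_pos[OF j(1)] additive_nonneg[OF X[OF j(1)]]
      by (intro sum.cong refl) (simp add: powr_divide powr_mult less_imp_le)
    also have "\<dots> \<le> 2 powr q j / (q j - 1) * ((2 ^ DIM('a) * (K * A j)) powr q j * vol c) / A j powr q j"
      by (intro divide_right_mono bound) simp
    also have "(2 ^ DIM('a) * (K * A j)) powr q j = (2 ^ DIM('a) * K) powr q j * A j powr q j"
      using A_pos[OF j(1)] K_ge_1 by (subst powr_mult[symmetric]) (auto simp: mult.assoc)
    finally show "(\<Sum>R\<in>upper (bad c) h c. \<Sum>k<N. w k R * (X j k R / vol R / A j) powr q j)
      \<le> 2 powr q j / (q j - 1) * ((2 ^ DIM('a) * K) powr q j * vol c)"
      using A_pos[OF j(1)] by simp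
  qed (use P K_ge_1 in auto)
  also have "\<dots> = sparse_const n p e DIM('a) * val c"
    by (simp add: sparse_const_def val_def P_def A_def J_def q_def sum_distrib_right sum_distrib_left mult_ac)
  finally show ?thesis .
qed

definition dominated :: "nat \<Rightarrow> 'a cell \<Rightarrow> bool" where
  "dominated h c \<longleftrightarrow>
     (\<exists>S. sparse_within (cube_of c) S \<and> sum form (desc h c) \<le> sparse_const n p e DIM('a) * (\<Sum>x\<in>S. val (fst x)))"

text \<open>Induction on the depth below a fixed root \<open>c0\<close>; \<open>V\<close> is the
  union of the maximal bad cells. Its size is controlled because \<open>K * vol\<close> is at most
  the additive right-hand side on each of them. The case of a bad \<open>c\<close> is a separate
  premise: below \<open>c0\<close> it follows from smaller depths, while at \<open>c0\<close> itself
  it is vacuous, as \<open>c0\<close> is not bad.\<close>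

lemma stopping_decomposition:
  assumes A: "\<And>j. j \<le> n \<Longrightarrow> 0 < B j c0"
  shows "(\<And>h' s. h' < h \<Longrightarrow> dominated h' s) \<Longrightarrow> (bad c0 c \<Longrightarrow> dominated h c) \<Longrightarrow>
    \<exists>V S. V \<in> sets lebesgue \<and> V \<subseteq> cube_of c \<and> sparse_within V S \<and>
      K * measure lebesgue V \<le> (\<Sum>j\<le>n. B j c / (B j c0 / vol c0)) \<and>
      sum form (desc h c) \<le> sum form (upper (bad c0) h c) + sparse_const n p e DIM('a) * (\<Sum>x\<in>S. val (fst x))"
proof (induction h arbitrary: c)
  have nonneg: "0 \<le> B j c / (B j c0 / vol c0)" if "j \<le> n" for j c
    using A[OF that] additive_nonneg[OF B[OF that], of c] by (simp add: less_imp_le)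
  have stop: "\<exists>V S. V \<in> sets lebesgue \<and> V \<subseteq> cube_of c \<and> sparse_within V S \<and>
      K * measure lebesgue V \<le> (\<Sum>j\<le>n. B j c / (B j c0 / vol c0)) \<and>
      sum form (desc h c) \<le> sum form (upper (bad c0) h c) + sparse_const n p e DIM('a) * (\<Sum>x\<in>S. val (fst x))"
    if "bad c0 c" "dominated h c" for h c
  proof -
    from that(2) obtain S where S: "sparse_within (cube_of c) S"
      "sum form (desc h c) \<le> sparse_const n p e DIM('a) * (\<Sum>x\<in>S. val (fst x))" unfolding dominated_def by blast
    from that(1) obtain j where j: "j \<le> n" "K * (B j c0 / vol c0) * vol c < B j c"
      unfolding bad_def by blast
    then have "K * vol c \<le> B j c / (B j c0 / vol c0)"
      using A[OF j(1)] by (subst pos_le_divide_eq) (auto simp: mult_ac)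
    also have "\<dots> \<le> (\<Sum>j\<le>n. B j c / (B j c0 / vol c0))"
      using j(1) nonneg by (intro member_le_sum) auto
    finally have "K * measure lebesgue (cube_of c) \<le> (\<Sum>j\<le>n. B j c / (B j c0 / vol c0))" by simp
    then show ?thesis using S upper_bad[of "bad c0" c h] that(1)
      by (intro exI[of _ "cube_of c"] exI[of _ S]) simp
  qed
  {
    case 0
    show ?case
    proof (cases "bad c0 c")
      case False
      have "0 \<le> (\<Sum>j\<le>n. B j c / (B j c0 / vol c0))" by (intro sum_nonneg nonneg) simp
      with False show ?thesis
        by (intro exI[of _ "{}"] exI[of _ "{}"]) (simp del: times_divide_eq_left divide_divide_eq_right)
    qed (use stop 0 in blast)
  next
    case (Suc h)
    show ?case
    proof (cases "bad c0 c")
      case False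
      define good where "good s V S \<longleftrightarrow> V \<in> sets lebesgue \<and> V \<subseteq> cube_of s \<and> sparse_within V S \<and>
          K * measure lebesgue V \<le> (\<Sum>j\<le>n. B j s / (B j c0 / vol c0)) \<and>
          sum form (desc h s) \<le> sum form (upper (bad c0) h s) + sparse_const n p e DIM('a) * (\<Sum>x\<in>S. val (fst x))"
        for s V S
      have "\<exists>V S. good s V S" for s
        unfolding good_def by (rule Suc.IH) (use Suc.prems(1) in auto)
      then obtain V S where good: "\<And>s. good s (V s) (S s)" by metis
      then have V: "\<And>s. V s \<in> sets lebesgue" "\<And>s. V s \<subseteq> cube_of s"
        and S: "\<And>s. sparse_within (V s) (S s)"
        and KV: "\<And>s. K * measure lebesgue (V s) \<le> (\<Sum>j\<le>n. B j s / (B j c0 / vol c0))"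
        and form: "\<And>s. sum form (desc h s) \<le> sum form (upper (bad c0) h s) + sparse_const n p e DIM('a) * (\<Sum>x\<in>S s. val (fst x))"
        unfolding good_def by blast+
      define VV where "VV = (\<Union>s\<in>children c. V s)"
      define SS where "SS = (\<Union>s\<in>children c. S s)"
      have disj: "disjoint_family_on V (children c)"
        using disjoint_children[of c] V(2) unfolding disjoint_family_on_def by blast
      have VV: "VV \<in> sets lebesgue" "VV \<subseteq> cube_of c"
        unfolding VV_def using V children_subset by (blast intro: sets.finite_UN finite_children)+
      have "sparse_within VV SS"
        unfolding VV_def SS_def by (rule sparse_within_UN(1)[OF finite_children disj S])
      moreover have "K * measure lebesgue VV \<le> (\<Sum>j\<le>n. B j c / (B j c0 / vol c0))"
      proof -
        have "V s \<in> lmeasurable" for s using fmeasurableI2[OF cube_of_lmeasurable V(2)] V(1) by blast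
        then have "measure lebesgue VV \<le> (\<Sum>s\<in>children c. measure lebesgue (V s))"
          unfolding VV_def by (intro measure_UNION_le) (auto simp: V)
        then have "K * measure lebesgue VV \<le> K * (\<Sum>s\<in>children c. measure lebesgue (V s))"
          using K_ge_1 by (intro mult_left_mono) auto
        also have "\<dots> \<le> (\<Sum>s\<in>children c. \<Sum>j\<le>n. B j s / (B j c0 / vol c0))"
          unfolding sum_distrib_left by (intro sum_mono KV)
        also have "\<dots> = (\<Sum>j\<le>n. (\<Sum>s\<in>children c. B j s) / (B j c0 / vol c0))"
          by (subst sum.swap) (simp only: sum_divide_distrib)
        also have "\<dots> = (\<Sum>j\<le>n. B j c / (B j c0 / vol c0))"
        proof (rule sum.cong)
          fix j assume "j \<in> {..n}"
          then show "(\<Sum>s\<in>children c. B j s) / (B j c0 / vol c0) = B j c / (B j c0 / vol c0)"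
            using additive_children[OF B, of j c] by simp
        qed simp
        finally show ?thesis .
      qed
      moreover have "sum form (desc (Suc h) c)
          \<le> sum form (upper (bad c0) (Suc h) c) + sparse_const n p e DIM('a) * (\<Sum>x\<in>SS. val (fst x))"
      proof -
        have "(\<Sum>s\<in>children c. sum form (desc h s))
            \<le> (\<Sum>s\<in>children c. sum form (upper (bad c0) h s) + sparse_const n p e DIM('a) * (\<Sum>x\<in>S s. val (fst x)))"
          by (intro sum_mono form)
        also have "\<dots> = (\<Sum>s\<in>children c. sum form (upper (bad c0) h s)) + sparse_const n p e DIM('a) * (\<Sum>x\<in>SS. val (fst x))"
          unfolding SS_def sparse_within_UN(2)[OF finite_children disj S] sum_distrib_left sum.distrib ..
        finally show ?thesis
          unfolding sum_desc_Suc sum_upper_Suc[of "bad c0", OF False] by linarith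
      qed
      ultimately show ?thesis using VV by blast
    qed (use stop Suc.prems in blast)
  }
qed

theorem dominated_all: "dominated h c"
proof (induction h arbitrary: c rule: less_induct)
  case (less h)
  show ?case
  proof (cases "\<forall>j\<le>n. 0 < B j c")
    case True
    then have A: "\<And>j. j \<le> n \<Longrightarrow> 0 < B j c" by blast
    have not_bad: "\<not> bad c c"
    proof
      assume "bad c c"
      then obtain j where j: "j \<le> n" "K * (B j c / vol c) * vol c < B j c" unfolding bad_def by blast
      then show False using mult_right_mono[OF K_ge_1, of "B j c"] A[OF j(1)] by simp
    qed
    obtain V S where V: "V \<in> sets lebesgue" "V \<subseteq> cube_of c" and S: "sparse_within V S"
      and KV: "K * measure lebesgue V \<le> (\<Sum>j\<le>n. B j c / (B j c / vol c))"
      and form: "sum form (desc h c) \<le> sum form (upper (bad c) h c) + sparse_const n p e DIM('a) * (\<Sum>x\<in>S. val (fst x))"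
      using stopping_decomposition[of c h c] A less.IH not_bad by blast
    define E where "E = cube_of c - V"
    define SS where "SS = insert (c, E) S"
    have "(\<Sum>j\<le>n. B j c / (B j c / vol c)) = (\<Sum>j\<le>n. vol c)"
      using A by (intro sum.cong refl) (simp add: less_imp_neq[symmetric])
    \<comment> \<open>Each normalised average on the root contributes exactly \<open>vol c\<close>,
      so the \<open>n + 1\<close> of them cancel the same factor in
      \<open>stopping_ratio\<close>.\<close>
    then have "(n + 1) * (4 * measure lebesgue V) \<le> (n + 1) * vol c"
      using KV by (simp add: stopping_ratio_def algebra_simps)
    then have "measure lebesgue V \<le> vol c / 4"
      by (subst (asm) mult_le_cancel_left_pos) auto
    moreover have "measure lebesgue E = vol c - measure lebesgue V"
      unfolding E_def using V measurable_measure_Diff[OF cube_of_lmeasurable V] by simp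
    ultimately have E: "vol c / 2 < measure lebesgue E" using vol_pos[of c] by linarith
    have E_sub: "E \<in> sets lebesgue" "E \<subseteq> cube_of c" "E \<inter> V = {}"
      unfolding E_def using V by (auto simp: fmeasurableD)
    have disj: "E \<inter> snd x = {}" if "x \<in> S" for x
      using sparse_within_memD(3)[OF S that] E_sub by blast
    then have notin: "(c, E) \<notin> S" using sparse_within_nonempty[OF S] by fastforce
    have "finite S" using S by (simp add: sparse_within_def)
    have "sparse_within (cube_of c) SS"
      using sparse_within_mono[OF S V(2)] E E_sub disj
      unfolding SS_def sparse_within_def disjoint_family_on_def by (auto simp: Int_commute)
    moreover have "sum form (desc h c) \<le> sparse_const n p e DIM('a) * (\<Sum>x\<in>SS. val (fst x))"
      using form form_upper_le[OF A, of h] notin \<open>finite S\<close> by (simp add: SS_def distrib_left)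
    ultimately show ?thesis unfolding dominated_def by blast
  next
    case False
    \<comment> \<open>A vanishing integral for one \<open>j\<close> makes that factor zero
      throughout the tree and for every \<open>k\<close>; the empty family suffices.\<close>
    then obtain j where j: "j \<le> n" "B j c \<le> 0" by (auto simp: not_less)
    have "form R = 0" if R: "R \<in> desc h c" for R
    proof -
      have "X j k R = 0" if "k < N" for k
        using X_le_B[OF j(1) that, of R] additive_desc_le[OF B[OF j(1)] R] j(2)
          additive_nonneg[OF X[OF j(1) that], of R] by linarith
      then have "(\<Prod>j\<le>n. (X j k R / vol R) powr (1 / p j)) = 0" if "k < N" for k
        using j(1) that by (intro prod_zero bexI[of _ j]) auto
      then show ?thesis unfolding form_def by (intro sum.neutral ballI) (simp del: prod_zero_iff)
    qed
    then show ?thesis unfolding dominated_def by (intro exI[of _ "{}"]) simp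
  qed
qed

end

subsection \<open>Integrals and the one-third trick\<close>

text \<open>Proof by duality: the vector \<open>I\<close> of integrals is tested against
  \<open>I k powr (q - 1)\<close>, and Hoelder's inequality for the sum over \<open>k\<close> is
  applied pointwise under the integral.\<close>

lemma integral_Minkowski:
  fixes g :: "nat \<Rightarrow> 'b \<Rightarrow> real" and G :: "'b \<Rightarrow> real"
  assumes q: "1 < q" and g: "\<And>k. k < N \<Longrightarrow> integrable M (g k)" and G: "integrable M G"
    and g0: "\<And>k x. k < N \<Longrightarrow> 0 \<le> g k x" and G0: "\<And>x. 0 \<le> G x"
    and le: "\<And>x. (\<Sum>k<N. g k x powr q) \<le> G x powr q"
  shows "(\<Sum>k<N. (\<integral>x. g k x \<partial>M) powr q) \<le> (\<integral>x. G x \<partial>M) powr q"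
proof -
  define I where "I k = (\<integral>x. g k x \<partial>M)" for k
  define T where "T = (\<Sum>k<N. I k powr q)"
  have I0: "0 \<le> I k" if "k < N" for k unfolding I_def using g0[OF that] by simp
  have T0: "0 \<le> T" unfolding T_def by (intro sum_nonneg) auto
  show ?thesis
  proof (cases "T = 0")
    case False
    define Y where "Y = T powr (1/q)"
    have Y: "0 < Y" "Y powr q = T" using False T0 q by (auto simp: Y_def powr_powr)
    \<comment> \<open>Hoelder's inequality, from Young's after normalisation: \<open>Y\<close> is
      the \<open>q\<close>-norm of \<open>I\<close>, and \<open>G x\<close> bounds that of the
      values \<open>g k x\<close>.\<close>
    have pt: "(\<Sum>k<N. I k powr (q - 1) * g k x) \<le> Y powr (q - 1) * G x" for x
    proof (cases "G x = 0")
      case True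
      then have "(\<Sum>k<N. g k x powr q) = 0" using le[of x] q by (intro antisym sum_nonneg) auto
      then have "g k x = 0" if "k < N" for k using that by (simp add: sum_nonneg_eq_0_iff)
      then show ?thesis using True by simp
    next
      case False
      then have Gx: "0 < G x" using G0[of x] by simp
      have "(\<Sum>k<N. (I k / Y) powr (q - 1) * (g k x / G x))
          \<le> (\<Sum>k<N. (1 - 1/q) * (I k / Y) powr q + (g k x / G x) powr q / q)"
        using q Y(1) Gx I0 g0 by (intro sum_mono Youngs_inequality_conjugate) auto
      also have "\<dots> = (1 - 1/q) * (\<Sum>k<N. (I k / Y) powr q) + (\<Sum>k<N. (g k x / G x) powr q) / q"
        by (simp add: sum.distrib sum_distrib_left sum_divide_distrib)
      also have "(\<Sum>k<N. (I k / Y) powr q) = 1"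
        using Y False T0 I0 \<open>T \<noteq> 0\<close> by (simp add: powr_divide less_imp_le T_def flip: sum_divide_distrib)
      also have "(\<Sum>k<N. (g k x / G x) powr q) = (\<Sum>k<N. g k x powr q) / G x powr q"
        using Gx g0 by (simp add: powr_divide less_imp_le sum_divide_distrib)
      also have "(1 - 1/q) * 1 + (\<Sum>k<N. g k x powr q) / G x powr q / q \<le> (1 - 1/q) * 1 + 1 / q"
        using le[of x] Gx q by (intro add_left_mono divide_right_mono) (auto simp: divide_le_eq)
      finally have "(\<Sum>k<N. (I k / Y) powr (q - 1) * (g k x / G x)) \<le> 1" by simp
      moreover have "(\<Sum>k<N. (I k / Y) powr (q - 1) * (g k x / G x))
          = (\<Sum>k<N. I k powr (q - 1) * g k x) / (Y powr (q - 1) * G x)"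
        using Y(1) I0 by (simp add: powr_divide less_imp_le sum_divide_distrib)
      ultimately show ?thesis using Y(1) Gx by (simp add: divide_le_eq)
    qed
    have "T = (\<Sum>k<N. I k powr (q - 1) * I k)"
      unfolding T_def
    proof (rule sum.cong)
      fix k assume "k \<in> {..<N}"
      then show "I k powr q = I k powr (q - 1) * I k"
        using I0[of k] by (cases "I k = 0") (auto simp: powr_diff)
    qed simp
    also have "\<dots> = (\<integral>x. (\<Sum>k<N. I k powr (q - 1) * g k x) \<partial>M)"
      using g by (subst Bochner_Integration.integral_sum) (auto simp: I_def)
    also have "\<dots> \<le> (\<integral>x. Y powr (q - 1) * G x \<partial>M)"
      using g G by (intro integral_mono pt Bochner_Integration.integrable_sum) auto
    also have "\<dots> = Y powr (q - 1) * (\<integral>x. G x \<partial>M)" by simp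
    finally have "Y powr (q - 1) * Y \<le> Y powr (q - 1) * (\<integral>x. G x \<partial>M)"
      using Y by (simp add: powr_diff)
    then have "Y \<le> (\<integral>x. G x \<partial>M)" using Y(1) by simp
    then have "Y powr q \<le> (\<integral>x. G x \<partial>M) powr q" using Y(1) q by (intro powr_mono2) auto
    then show ?thesis using Y(2) by (simp add: T_def I_def)
  qed (simp add: T_def I_def)
qed

lemma integrable_bounded_support:
  fixes f :: "'a::euclidean_space \<Rightarrow> real"
  assumes f: "f \<in> borel_measurable lebesgue" and M: "\<And>x. \<bar>f x\<bar> \<le> M" and supp: "bounded {x. f x \<noteq> 0}"
  shows "integrable lebesgue f"
proof -
  have "{x. f x \<noteq> 0} = {x \<in> space lebesgue. f x \<noteq> 0}" by simp
  also have "\<dots> \<in> sets lebesgue" using f by measurable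
  finally have "{x. f x \<noteq> 0} \<in> lmeasurable" using supp by (intro bounded_set_imp_lmeasurable)
  then have "integrable lebesgue (\<lambda>x. M * indicator {x. f x \<noteq> 0} x)"
    by (intro integrable_mult_right integrable_real_indicator) (auto simp: fmeasurable_def)
  then show ?thesis
    using f by (rule Bochner_Integration.integrable_bound)
      (use M in \<open>auto simp: indicator_def intro: order_trans[OF _ abs_ge_self]\<close>)
qed

section \<open>Pointwise \<open>r\<close>-norms of finite sequences of functions\<close>

lemma lr_norm_nonneg: "1 \<le> N \<Longrightarrow> 0 \<le> lr_norm r N v"
  unfolding lr_norm_def by (auto intro!: Max.coboundedI order_trans[OF norm_ge_zero[of "v 0"]])

lemma norm_le_lr_norm:
  assumes "1 \<le> r" "k < N" shows "norm (v k) \<le> lr_norm r N v"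
proof (cases r)
  case (real \<rho>)
  with assms have \<rho>: "1 \<le> \<rho>" by simp
  have "norm (v k) powr \<rho> \<le> (\<Sum>k<N. norm (v k) powr \<rho>)"
    using assms(2) by (intro member_le_sum) auto
  then have "(norm (v k) powr \<rho>) powr (1/\<rho>) \<le> (\<Sum>k<N. norm (v k) powr \<rho>) powr (1/\<rho>)"
    using \<rho> by (intro powr_mono2) auto
  then show ?thesis using \<rho> real by (simp add: lr_norm_def powr_powr)
qed (use assms in \<open>auto simp: lr_norm_def\<close>)

lemma lr_norm_powr:
  assumes "1 \<le> \<rho>" shows "lr_norm (ereal \<rho>) N v powr \<rho> = (\<Sum>k<N. norm (v k) powr \<rho>)"
proof -
  have "0 \<le> (\<Sum>k<N. norm (v k) powr \<rho>)" by (intro sum_nonneg) auto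
  then show ?thesis using assms by (simp add: lr_norm_def powr_powr)
qed

lemma lr_norm_mono:
  assumes "1 \<le> r" "1 \<le> N" "\<And>k. k < N \<Longrightarrow> norm (v k) \<le> norm (u k)"
  shows "lr_norm r N v \<le> lr_norm r N u"
proof (cases r)
  case (real \<rho>)
  with assms show ?thesis
    by (auto simp: lr_norm_def intro!: powr_mono2 sum_mono sum_nonneg)
next
  case PInf
  have "norm (v k) \<le> Max ((\<lambda>k. norm (u k)) ` {..<N})" if "k < N" for k
    using that by (intro order_trans[OF assms(3)] Max_ge) auto
  then show ?thesis using PInf assms(2) by (auto simp: lr_norm_def lessThan_empty_iff)
qed (use assms in auto)

lemma lr_norm_zero: "1 \<le> N \<Longrightarrow> (\<And>k. k < N \<Longrightarrow> v k = 0) \<Longrightarrow> lr_norm r N v = 0"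
proof -
  assume N: "1 \<le> N" and v: "\<And>k. k < N \<Longrightarrow> v k = 0"
  then have "(\<lambda>k. norm (v k)) ` {..<N} = {0}" by (auto simp: image_iff intro!: exI[of _ 0])
  then show ?thesis using v by (simp add: lr_norm_def)
qed

lemma borel_measurable_lr_norm:
  assumes "1 \<le> N" "\<And>k. k < N \<Longrightarrow> f k \<in> borel_measurable M"
  shows "(\<lambda>x. lr_norm r N (\<lambda>k. f k x)) \<in> borel_measurable M"
proof (cases "r = \<infinity>")
  case True
  have "(\<lambda>x. Max ((\<lambda>k. norm (f k x)) ` {..<N})) \<in> borel_measurable M"
    using assms by (intro borel_measurable_Max) auto
  then show ?thesis using True by (simp add: lr_norm_def)
next
  case False
  have "(\<lambda>x. (\<Sum>k<N. norm (f k x) powr real_of_ereal r) powr (1 / real_of_ereal r)) \<in> borel_measurable M"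
    using assms by (intro powr_real_measurable borel_measurable_sum) auto
  then show ?thesis using False by (simp add: lr_norm_def)
qed

lemma integrable_lr_norm_powr:
  fixes F :: "nat \<Rightarrow> 'a::euclidean_space \<Rightarrow> complex"
  assumes r: "1 \<le> r" and N: "1 \<le> N" and F: "\<And>k. k < N \<Longrightarrow> F k \<in> Linf0" and p: "1 \<le> p"
  shows "integrable lebesgue (\<lambda>x. lr_norm r N (\<lambda>k. F k x) powr p)"
proof -
  have "bounded (\<Union>k<N. range (F k))" using F by (intro bounded_UN) (auto simp: Linf0_def)
  then obtain m where m: "\<And>k x. k < N \<Longrightarrow> norm (F k x) \<le> m" unfolding bounded_iff by blast
  show ?thesis
  proof (rule integrable_bounded_support)
    show "(\<lambda>x. lr_norm r N (\<lambda>k. F k x) powr p) \<in> borel_measurable lebesgue"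
      using F N by (intro powr_real_measurable borel_measurable_lr_norm) (auto simp: Linf0_def)
    show "\<bar>lr_norm r N (\<lambda>k. F k x) powr p\<bar> \<le> lr_norm r N (\<lambda>k. complex_of_real m) powr p" for x
    proof -
      have "lr_norm r N (\<lambda>k. F k x) \<le> lr_norm r N (\<lambda>k. complex_of_real m)"
        using m by (intro lr_norm_mono r N) (fastforce intro: order_trans[OF _ abs_ge_self])
      then show ?thesis using p lr_norm_nonneg[OF N] by (auto intro!: powr_mono2)
    qed
    have "bounded (\<Union>k<N. {x. F k x \<noteq> 0})" using F by (intro bounded_UN) (auto simp: Linf0_def)
    moreover have "{x. lr_norm r N (\<lambda>k. F k x) powr p \<noteq> 0} \<subseteq> (\<Union>k<N. {x. F k x \<noteq> 0})"
    proof
      fix x assume x: "x \<in> {x. lr_norm r N (\<lambda>k. F k x) powr p \<noteq> 0}"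
      have "\<exists>k<N. F k x \<noteq> 0"
      proof (rule ccontr)
        assume "\<not> (\<exists>k<N. F k x \<noteq> 0)"
        then have "lr_norm r N (\<lambda>k. F k x) = 0" by (intro lr_norm_zero N) blast
        with x show False by simp
      qed
      then show "x \<in> (\<Union>k<N. {x. F k x \<noteq> 0})" by blast
    qed
    ultimately show "bounded {x. lr_norm r N (\<lambda>k. F k x) powr p \<noteq> 0}" by (rule bounded_subset)
  qed
qed

lemma integrable_norm_powr:
  fixes f :: "'a::euclidean_space \<Rightarrow> complex"
  assumes "f \<in> Linf0" "1 \<le> p"
  shows "integrable lebesgue (\<lambda>x. norm (f x) powr p)"
  using integrable_lr_norm_powr[of 1 1 "\<lambda>_. f" p] assms by (simp add: lr_norm_def)

lemma integrable_imp_set_integrable: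
  fixes f :: "'b \<Rightarrow> real"
  shows "integrable M f \<Longrightarrow> A \<in> sets M \<Longrightarrow> set_integrable M A f"
  unfolding set_integrable_def by (rule integrable_mult_indicator)

text \<open>The lattice position of the corner is recorded because the one-third trick compares the
  grids of differently shifted top cells.\<close>

lemma desc_cell_at:
  assumes "x \<in> cube_of c"
  shows "\<exists>s\<in>desc i c. x \<in> cube_of s \<and> side s = side c / 2 ^ i \<and>
    (\<forall>b\<in>Basis. \<exists>z::int. fst s \<bullet> b = fst c \<bullet> b + of_int z * side s)"
  using assms
proof (induction i arbitrary: c)
  case 0
  then show ?case by (auto intro!: exI[of _ "0::int"])
next
  case (Suc i)
  then obtain t where t: "t \<in> children c" "x \<in> cube_of t" using cube_of_children by blast
  obtain s where s: "s \<in> desc i t" "x \<in> cube_of s" "side s = side t / 2 ^ i"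
    and z: "\<forall>b\<in>Basis. \<exists>z::int. fst s \<bullet> b = fst t \<bullet> b + of_int z * side s"
    using Suc.IH[OF t(2)] by blast
  have side: "side c = 2 ^ Suc i * side s" using s(3) side_children[OF t(1)] by simp
  obtain A where A: "A \<subseteq> Basis" "t = (fst c + (side c / 2) *\<^sub>R \<Sum>A, snd c - 1)"
    using t(1) by (auto simp: children_def)
  have "\<exists>z::int. fst s \<bullet> b = fst c \<bullet> b + of_int z * side s" if b: "b \<in> Basis" for b
  proof -
    obtain z :: int where "fst s \<bullet> b = fst t \<bullet> b + of_int z * side s" using z b by blast
    then have "fst s \<bullet> b = fst c \<bullet> b + of_int (z + (if b \<in> A then 2 ^ i else 0)) * side s"
      using A b side by (simp add: inner_add_left inner_sum_Basis algebra_simps)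
    then show ?thesis by blast
  qed
  then show ?case using s t(1) side by (intro bexI[of _ s]) auto
qed

text \<open>With \<open>S = 2 powr t\<close>, coordinates in \<open>A\<close> use the interval
  \<open>[-2S/3, S/3)\<close> and the others \<open>[-S/3, 2S/3)\<close>. Every choice of
  \<open>A\<close> contains a neighbourhood of the origin.\<close>

definition top_cell :: "real \<Rightarrow> 'a::euclidean_space set \<Rightarrow> 'a cell" where
  "top_cell t A = (- (2 powr t / 3) *\<^sub>R (One + \<Sum>A), t)"

lemma fst_top_cell:
  "A \<subseteq> Basis \<Longrightarrow> b \<in> Basis \<Longrightarrow> fst (top_cell t A) \<bullet> b = (if b \<in> A then - 2 * 2 powr t / 3 else - (2 powr t) / 3)"
  by (simp add: top_cell_def inner_add_left inner_sum_Basis algebra_simps)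

text \<open>The one-third trick. The dyadic subdivision points of \<open>[-S/3, 2S/3)\<close> and \<open>[-2S/3, S/3)\<close> at scale
  \<open>S / 2\<^sup>i\<close> stay \<open>S / (3 \<cdot> 2\<^sup>i)\<close> apart, so an interval shorter than that misses one of the two families.\<close>

lemma one_third_trick:
  fixes a :: "'a::euclidean_space"
  assumes l: "0 < l" and small: "\<And>b. b \<in> Basis \<Longrightarrow> \<bar>a \<bullet> b\<bar> < 2 powr t / 6" "3 * l < 2 powr t"
  shows "\<exists>A i R. A \<subseteq> Basis \<and> R \<in> desc i (top_cell t A) \<and> cbox a (a + l *\<^sub>R One) \<subseteq> cube_of R \<and> side R \<le> 6 * l"
proof -
  define S where "S = (2::real) powr t"
  have S: "0 < S" by (simp add: S_def)
  \<comment> \<open>The aim is the last generation \<open>i\<close> whose side exceeds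
    \<open>3 * l\<close>; since the next side does not, the side at \<open>i\<close> is at most
    \<open>6 * l\<close>.\<close>
  obtain m where "S / (3 * l) < 2 ^ m" using real_arch_pow[of 2 "S / (3 * l)"] by auto
  then have "S / 2 ^ m \<le> 3 * l" using l by (simp add: field_simps)
  moreover have "\<not> S / 2 ^ 0 \<le> 3 * l" using small(2) by (simp add: S_def)
  ultimately obtain i where i: "\<not> S / 2 ^ i \<le> 3 * l" "S / 2 ^ Suc i \<le> 3 * l"
    using ex_least_nat_less[of "\<lambda>i. S / 2 ^ i \<le> 3 * l" m] by blast
  define \<delta> where "\<delta> = S / 2 ^ i"
  have \<delta>: "0 < \<delta>" "3 * l < \<delta>" "\<delta> \<le> 6 * l" "S = 2 ^ i * \<delta>"
    using i S by (auto simp: \<delta>_def)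
  \<comment> \<open>A grid point of the family starting at \<open>- s / 3\<close> cuts the interval.
    The left end is excluded and the right end included, because a closed interval must fit into a
    half-open one.\<close>
  define hit where "hit b s \<longleftrightarrow> (\<exists>z::int. a \<bullet> b < - s / 3 + of_int z * \<delta> \<and> - s / 3 + of_int z * \<delta> \<le> a \<bullet> b + l)"
    for b :: 'a and s
  have not_both: "\<not> (hit b S \<and> hit b (2 * S))" for b
  proof
    assume "hit b S \<and> hit b (2 * S)"
    then obtain y z :: int where
      "a \<bullet> b < - S / 3 + of_int y * \<delta>" "- S / 3 + of_int y * \<delta> \<le> a \<bullet> b + l"
      "a \<bullet> b < - (2 * S) / 3 + of_int z * \<delta>" "- (2 * S) / 3 + of_int z * \<delta> \<le> a \<bullet> b + l"
      unfolding hit_def by blast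
    \<comment> \<open>Two hits lie within \<open>l\<close> of each other. Their distance is a
      multiple of \<open>\<delta> / 3\<close> and \<open>3 * l < \<delta>\<close>, so it is zero,
      which would make 3 divide \<open>2 ^ i\<close>.\<close>
    then have "\<bar>S + 3 * (of_int y * \<delta>) - 3 * (of_int z * \<delta>)\<bar> < \<delta>" using \<delta>(2) by linarith
    moreover have "S + 3 * (of_int y * \<delta>) - 3 * (of_int z * \<delta>) = of_int (2 ^ i + 3 * (y - z)) * \<delta>"
      by (simp add: \<delta>(4) algebra_simps)
    ultimately have "\<bar>of_int (2 ^ i + 3 * (y - z))\<bar> * \<delta> < 1 * \<delta>"
      using \<delta>(1) by (simp only: abs_mult abs_of_pos mult_1)
    then have "\<bar>of_int (2 ^ i + 3 * (y - z)) :: real\<bar> < 1" using \<delta>(1) by (simp only: mult_less_cancel_right_pos)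
    then have "2 ^ i + 3 * (y - z) = 0" by linarith
    then have "(3::int) dvd 2 ^ i" by (metis add_diff_cancel_right' diff_0 dvd_minus_iff dvd_triv_left)
    then have "(3::int) dvd 2" by (rule prime_dvd_power[rotated]) simp
    then show False by simp
  qed
  \<comment> \<open>The alternative shift is taken exactly in the coordinates where the first family
    is hit.\<close>
  define A where "A = {b\<in>Basis. hit b S}"
  have A: "A \<subseteq> Basis" by (auto simp: A_def)
  let ?c = "top_cell t A"
  have side_c: "side ?c = S" by (simp add: side_def top_cell_def S_def)
  have "a \<in> cube_of ?c"
    unfolding cube_of_def mem_Collect_eq side_c
  proof (intro ballI)
    fix b :: 'a assume b: "b \<in> Basis"
    then show "fst ?c \<bullet> b \<le> a \<bullet> b \<and> a \<bullet> b < fst ?c \<bullet> b + S"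
      using small(1)[OF b] S fst_top_cell[OF A b, of t] by (auto simp: S_def)
  qed
  then obtain R where R: "R \<in> desc i ?c" "a \<in> cube_of R" "side R = \<delta>"
    and z: "\<And>b. b \<in> Basis \<Longrightarrow> \<exists>z::int. fst R \<bullet> b = fst ?c \<bullet> b + of_int z * \<delta>"
    using desc_cell_at[of a ?c i] unfolding side_c \<delta>_def by metis
  have "cbox a (a + l *\<^sub>R One) \<subseteq> cube_of R"
  proof
    fix x assume x: "x \<in> cbox a (a + l *\<^sub>R One)"
    show "x \<in> cube_of R"
      unfolding cube_of_def mem_Collect_eq R(3)
    proof (intro ballI)
      fix b :: 'a assume b: "b \<in> Basis"
      have ab: "fst R \<bullet> b \<le> a \<bullet> b" "a \<bullet> b < fst R \<bullet> b + \<delta>"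
        using R(2) b unfolding cube_of_def R(3) by auto
      have xb: "a \<bullet> b \<le> x \<bullet> b" "x \<bullet> b \<le> a \<bullet> b + l"
        using x b by (auto simp: mem_box inner_add_left)
      obtain z :: int where z: "fst R \<bullet> b = fst ?c \<bullet> b + of_int z * \<delta>" using z[OF b] by blast
      have "\<not> fst R \<bullet> b + \<delta> \<le> a \<bullet> b + l"
      proof
        assume le: "fst R \<bullet> b + \<delta> \<le> a \<bullet> b + l"
        have eq: "fst R \<bullet> b + \<delta> = fst ?c \<bullet> b + of_int (z + 1) * \<delta>"
          using z by (simp add: algebra_simps)
        show False
        proof (cases "b \<in> A")
          case True
          then have "fst ?c \<bullet> b = - (2 * S) / 3" using fst_top_cell[OF A b, of t] by (simp add: S_def)
          then have "hit b (2 * S)" unfolding hit_def using le ab(2) eq by metis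
          then show False using True not_both by (simp add: A_def)
        next
          case False
          then have "fst ?c \<bullet> b = - S / 3" using fst_top_cell[OF A b, of t] by (simp add: S_def)
          then have "hit b S" unfolding hit_def using le ab(2) eq by metis
          then show False using False b by (simp add: A_def)
        qed
      qed
      then show "fst R \<bullet> b \<le> x \<bullet> b \<and> x \<bullet> b < fst R \<bullet> b + \<delta>" using ab xb by linarith
    qed
  qed
  then show ?thesis using A R \<delta>(3) by metis
qed

text \<open>Members of \<open>sparse\<close> collections are closed cubes while the tree uses
  half-open cells; this passes from the latter to the former at equal volume.\<close>

definition closed_cube :: "'a::euclidean_space cell \<Rightarrow> 'a set" where
  "closed_cube c = cbox (fst c) (fst c + side c *\<^sub>R One)"

lemma measure_closed_cube: "measure lebesgue (closed_cube c) = vol c"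
  using measure_cbox_side[of "side c" "fst c"] by (simp add: closed_cube_def vol_def less_imp_le)

lemma is_cube_closed_cube: "is_cube (closed_cube c)"
  unfolding is_cube_def closed_cube_def using side_pos by blast

lemma lmeasurable_closed_cube: "closed_cube c \<in> lmeasurable"
  by (simp add: closed_cube_def)

lemma cube_of_subset_closed_cube: "cube_of c \<subseteq> closed_cube c"
  unfolding closed_cube_def by (rule cube_of_subset_cbox)

text \<open>Two distinct members of a sparse family cannot share a cube: it would contain two disjoint sets,
  each of more than half its measure.\<close>

lemma inj_on_closed_cube:
  assumes S: "sparse_within V S" shows "inj_on (\<lambda>x. closed_cube (fst x)) S"
proof (rule inj_onI, rule ccontr)
  fix x y assume xy: "x \<in> S" "y \<in> S" "closed_cube (fst x) = closed_cube (fst y)" "x \<noteq> y"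
  have vol: "vol (fst x) = vol (fst y)" using xy(3) measure_closed_cube by metis
  note X = sparse_within_memD[OF S xy(1)] and Y = sparse_within_memD[OF S xy(2)]
  have sub: "snd x \<subseteq> closed_cube (fst x)" "snd y \<subseteq> closed_cube (fst x)"
    using X(2) Y(2) xy(3) cube_of_subset_closed_cube by blast+
  have meas: "snd x \<in> lmeasurable" "snd y \<in> lmeasurable"
    using fmeasurableI2[OF lmeasurable_closed_cube] sub X(1) Y(1) by blast+
  have "snd x \<inter> snd y = {}"
    using S xy(1,2,4) unfolding sparse_within_def disjoint_family_on_def by blast
  then have "measure lebesgue (snd x) + measure lebesgue (snd y) = measure lebesgue (snd x \<union> snd y)"
    using meas by (subst measure_Un2) (simp_all add: Diff_triv Int_commute)
  also have "\<dots> \<le> measure lebesgue (closed_cube (fst x))"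
    using sub X(1) Y(1) by (intro measure_mono_fmeasurable lmeasurable_closed_cube) auto
  also have "\<dots> = vol (fst x)" by (rule measure_closed_cube)
  finally show False using X(4) Y(4) vol by linarith
qed

text \<open>Witnesses are attached to pairs, whereas \<open>sparse\<close> asks for a function of
  the cube; injectivity provides it through an inverse.\<close>

lemma sparse_closed_cubes:
  assumes S: "sparse_within V S" shows "sparse ((\<lambda>x. closed_cube (fst x)) ` S)"
proof -
  define f where "f x = closed_cube (fst x)" for x :: "'a cell \<times> 'a set"
  define g where "g = the_inv_into S f"
  have inj: "inj_on f S" using inj_on_closed_cube[OF S] by (simp add: f_def[abs_def])
  have g: "g (f x) = x" if "x \<in> S" for x using the_inv_into_f_f[OF inj that] by (simp add: g_def)
  have "finite S" using S by (simp add: sparse_within_def)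
  moreover have "snd (g (f x)) \<in> sets lebesgue \<and> snd (g (f x)) \<subseteq> f x
      \<and> measure lebesgue (snd (g (f x))) > measure lebesgue (f x) / 2" if x: "x \<in> S" for x
    using sparse_within_memD[OF S x] cube_of_subset_closed_cube[of "fst x"] unfolding g[OF x]
    by (auto simp: f_def measure_closed_cube)
  moreover have "disjoint_family_on (\<lambda>Q. snd (g Q)) (f ` S)"
    unfolding disjoint_family_on_def
  proof (intro ballI impI)
    fix P Q assume "P \<in> f ` S" "Q \<in> f ` S" "P \<noteq> Q"
    then obtain x y where xy: "x \<in> S" "y \<in> S" "P = f x" "Q = f y" "x \<noteq> y" by blast
    then show "snd (g P) \<inter> snd (g Q) = {}"
      using S g unfolding sparse_within_def disjoint_family_on_def by metis
  qed
  ultimately have "sparse (f ` S)"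
    unfolding sparse_def
    by (intro conjI exI[of _ "\<lambda>Q. snd (g Q)"]) (auto simp: f_def is_cube_closed_cube countable_finite)
  then show ?thesis by (simp add: f_def[abs_def])
qed

lemma set_integral_subset_le:
  fixes f :: "'b \<Rightarrow> real"
  assumes "integrable M f" "\<And>x. 0 \<le> f x" "A \<in> sets M" "B \<in> sets M" "A \<subseteq> B"
  shows "(LINT x:A|M. f x) \<le> (LINT x:B|M. f x)"
  using assms unfolding set_lebesgue_integral_def
  by (intro integral_mono integrable_mult_indicator) (auto simp: indicator_def)

lemma cell_average_le_avg:
  fixes f :: "'a::euclidean_space \<Rightarrow> 'b::real_normed_vector"
  assumes f: "integrable lebesgue (\<lambda>x. norm (f x) powr p)" and p: "1 \<le> p"
  shows "((LINT x:cube_of c|lebesgue. norm (f x) powr p) / vol c) powr (1 / p) \<le> avg p (closed_cube c) f"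
proof -
  have "(LINT x:cube_of c|lebesgue. norm (f x) powr p) \<le> (LINT x:closed_cube c|lebesgue. norm (f x) powr p)"
    using cube_of_subset_closed_cube[of c] f lmeasurable_closed_cube[of c]
    by (intro set_integral_subset_le) (auto simp: fmeasurableD)
  moreover have "0 \<le> (LINT x:cube_of c|lebesgue. norm (f x) powr p)"
    unfolding set_lebesgue_integral_def by (intro Bochner_Integration.integral_nonneg) auto
  ultimately show ?thesis
    using p unfolding avg_def measure_closed_cube
    by (subst powr_divide) (auto intro!: divide_right_mono powr_mono2)
qed

text \<open>The cell contains the cube and has at most \<open>6 ^ d\<close> times its volume; since
  \<open>1 / p \<le> 1\<close>, taking the root does not enlarge this factor.\<close>

lemma avg_le_cell_average:
  fixes f :: "'a::euclidean_space \<Rightarrow> 'b::real_normed_vector"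
  assumes f: "integrable lebesgue (\<lambda>x. norm (f x) powr p)" and p: "1 \<le> p" and l: "0 < l"
    and sub: "cbox a (a + l *\<^sub>R One) \<subseteq> cube_of c" and side: "side c \<le> 6 * l"
  shows "avg p (cbox a (a + l *\<^sub>R One)) f
    \<le> 6 ^ DIM('a) * ((LINT x:cube_of c|lebesgue. norm (f x) powr p) / vol c) powr (1 / p)"
proof -
  let ?Q = "cbox a (a + l *\<^sub>R One)"
  let ?I = "LINT x:cube_of c|lebesgue. norm (f x) powr p"
  let ?J = "LINT x:?Q|lebesgue. norm (f x) powr p"
  have Q: "measure lebesgue ?Q = l ^ DIM('a)" using measure_cbox_side[of l a] l by simp
  have J: "0 \<le> ?J" unfolding set_lebesgue_integral_def by (intro Bochner_Integration.integral_nonneg) auto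
  have JI: "?J \<le> ?I"
    using f sub by (intro set_integral_subset_le) (auto simp: fmeasurableD)
  have "side c ^ DIM('a) \<le> (6 * l) ^ DIM('a)"
    using side side_pos[of c] by (intro power_mono) (auto simp: less_imp_le)
  then have "vol c \<le> 6 ^ DIM('a) * l ^ DIM('a)"
    unfolding vol_def power_mult_distrib .
  then have "?J * vol c \<le> ?I * (6 ^ DIM('a) * l ^ DIM('a))"
    using J JI l by (intro mult_mono) auto
  then have "?J * vol c / (vol c * l ^ DIM('a)) \<le> ?I * (6 ^ DIM('a) * l ^ DIM('a)) / (vol c * l ^ DIM('a))"
    using l by (intro divide_right_mono) auto
  then have "?J / l ^ DIM('a) \<le> 6 ^ DIM('a) * (?I / vol c)"
    using l by (simp add: mult_ac)
  then have "(?J / l ^ DIM('a)) powr (1 / p) \<le> (6 ^ DIM('a) * (?I / vol c)) powr (1 / p)"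
    using J l p by (intro powr_mono2) auto
  also have "\<dots> = (6 ^ DIM('a)) powr (1 / p) * (?I / vol c) powr (1 / p)"
    by (rule powr_mult)
  also have "\<dots> \<le> (6 ^ DIM('a)) powr 1 * (?I / vol c) powr (1 / p)"
    using p by (intro mult_right_mono powr_mono) auto
  finally show ?thesis
    using J l unfolding avg_def Q by (simp add: powr_divide)
qed

lemma dyadic_data_integrals:
  fixes F :: "nat \<Rightarrow> nat \<Rightarrow> 'a::euclidean_space \<Rightarrow> complex"
  assumes p: "\<And>j. j \<le> n \<Longrightarrow> 1 \<le> p j" and r: "\<And>j. j \<le> n \<Longrightarrow> 1 \<le> r j"
    and sum_r: "(\<Sum>j\<le>n. recip (r j)) = 1" and pr: "\<And>j. j \<le> n \<Longrightarrow> ereal (p j) < r j"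
    and N: "1 \<le> N" and F: "\<And>j k. j \<le> n \<Longrightarrow> k < N \<Longrightarrow> F j k \<in> Linf0"
    and w: "\<And>k c. k < N \<Longrightarrow> 0 \<le> w k c"
    and carleson: "\<And>k h c. k < N \<Longrightarrow> sum (w k) (desc h c) \<le> vol c"
  shows "dyadic_data n N p (\<lambda>j. recip (r j)) w
    (\<lambda>j k c. LINT x:cube_of c|lebesgue. norm (F j k x) powr p j)
    (\<lambda>j c. LINT x:cube_of c|lebesgue. lr_norm (r j) N (\<lambda>k. F j k x) powr p j)"
proof
  have int_F: "set_integrable lebesgue (cube_of c) (\<lambda>x. norm (F j k x) powr p j)" if "j \<le> n" "k < N" for j k c
    using F[OF that] p[OF that(1)] by (intro integrable_imp_set_integrable integrable_norm_powr) auto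
  have int_G: "set_integrable lebesgue (cube_of c) (\<lambda>x. lr_norm (r j) N (\<lambda>k. F j k x) powr p j)"
    if "j \<le> n" for j c
    using F[OF that] p[OF that] r[OF that] N
    by (intro integrable_imp_set_integrable integrable_lr_norm_powr) auto
  have real_r: "\<exists>\<rho>. r j = ereal \<rho> \<and> p j < \<rho> \<and> recip (r j) = 1 / \<rho>" if "j \<le> n" "r j \<noteq> \<infinity>" for j
    using pr[OF that(1)] that(2) by (cases "r j") (auto simp: recip_def)
  fix j assume j: "j \<le> n"
  show "0 \<le> recip (r j)" "recip (r j) * p j < 1"
    using real_r[OF j] p[OF j] by (cases "r j = \<infinity>"; force simp: recip_def)+
  show "additive (\<lambda>c. LINT x:cube_of c|lebesgue. lr_norm (r j) N (\<lambda>k. F j k x) powr p j)"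
    using int_G[OF j] by (intro additive_integral) auto
  {
    fix k assume k: "k < N"
    show "additive (\<lambda>c. LINT x:cube_of c|lebesgue. norm (F j k x) powr p j)"
      using int_F[OF j k] by (intro additive_integral) auto
    fix c
    show "(LINT x:cube_of c|lebesgue. norm (F j k x) powr p j)
        \<le> (LINT x:cube_of c|lebesgue. lr_norm (r j) N (\<lambda>k. F j k x) powr p j)"
      using norm_le_lr_norm[OF r[OF j] k] p[OF j]
      by (intro set_integral_mono int_F[OF j k] int_G[OF j] powr_mono2) auto
  }
  fix c assume pos: "0 < recip (r j)"
  then have "r j \<noteq> \<infinity>" by (auto simp: recip_def)
  then obtain \<rho> where \<rho>: "r j = ereal \<rho>" "p j < \<rho>" "recip (r j) = 1 / \<rho>" using real_r[OF j] by blast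
  \<comment> \<open>This is \<open>r j / p j\<close>, so the \<open>q\<close>-th power of a
    \<open>p j\<close>-th power is an \<open>r j\<close>-th power, and the pointwise hypothesis of
    Minkowski's inequality holds with equality.\<close>
  define q where "q = 1 / (recip (r j) * p j)"
  have q: "1 < q" "p j * q = \<rho>" using \<rho> p[OF j] by (auto simp: q_def)
  have ind: "(indicator A x *\<^sub>R y) powr q = indicator A x * y powr q" for A and x :: 'a and y :: real
    by (simp add: indicator_def)
  show "(\<Sum>k<N. (LINT x:cube_of c|lebesgue. norm (F j k x) powr p j) powr (1 / (recip (r j) * p j)))
    \<le> (LINT x:cube_of c|lebesgue. lr_norm (r j) N (\<lambda>k. F j k x) powr p j) powr (1 / (recip (r j) * p j))"
    unfolding set_lebesgue_integral_def q_def[symmetric]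
  proof (rule integral_Minkowski[OF q(1)])
    fix x
    have "(\<Sum>k<N. (norm (F j k x) powr p j) powr q) = (lr_norm (r j) N (\<lambda>k. F j k x) powr p j) powr q"
      unfolding powr_powr q(2) \<rho>(1) using \<rho>(2) p[OF j] by (subst lr_norm_powr) auto
    then show "(\<Sum>k<N. (indicat_real (cube_of c) x *\<^sub>R norm (F j k x) powr p j) powr q)
        \<le> (indicat_real (cube_of c) x *\<^sub>R lr_norm (r j) N (\<lambda>k. F j k x) powr p j) powr q"
      unfolding ind by (simp flip: sum_distrib_left)
  qed (use int_F[OF j] int_G[OF j] in \<open>auto simp: set_integrable_def\<close>)
qed (use p sum_r w carleson in auto)

subsection \<open>Domination of sparse forms\<close>

text \<open>The factor 2 replaces the volume of a cube by that of its witness set,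
  \<open>6 ^ d\<close> is paid for each of the \<open>n + 1\<close> averages, and
  \<open>2 ^ d\<close> counts the trees.\<close>

definition domination_const :: "nat \<Rightarrow> (nat \<Rightarrow> real) \<Rightarrow> (nat \<Rightarrow> ereal) \<Rightarrow> nat \<Rightarrow> real" where
  "domination_const n p r d = 2 * (6 ^ d) ^ (n + 1) * 2 ^ d * sparse_const n p (\<lambda>j. recip (r j)) d"

lemma sparse_form_domination:
  fixes F :: "nat \<Rightarrow> nat \<Rightarrow> 'a::euclidean_space \<Rightarrow> complex" and \<F> :: "nat \<Rightarrow> 'a set set"
  assumes p: "\<And>j. j \<le> n \<Longrightarrow> 1 \<le> p j" and r: "\<And>j. j \<le> n \<Longrightarrow> 1 \<le> r j"
    and sum_r: "(\<Sum>j\<le>n. recip (r j)) = 1" and pr: "\<And>j. j \<le> n \<Longrightarrow> ereal (p j) < r j"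
    and N: "1 \<le> N" and F: "\<And>j k. j \<le> n \<Longrightarrow> k < N \<Longrightarrow> F j k \<in> Linf0"
    and fin: "\<And>k. k < N \<Longrightarrow> finite (\<F> k)" and sparse: "\<And>k. k < N \<Longrightarrow> sparse (\<F> k)"
  shows "\<exists>\<Q>. finite \<Q> \<and> sparse \<Q> \<and>
    (\<Sum>k<N. \<Sum>Q\<in>\<F> k. measure lebesgue Q * (\<Prod>j\<le>n. avg (p j) Q (F j k)))
    \<le> domination_const n p r DIM('a) *
      (\<Sum>Q\<in>\<Q>. measure lebesgue Q * (\<Prod>j\<le>n. avg (p j) Q (\<lambda>x. lr_norm (r j) N (\<lambda>k. F j k x))))"
proof -
  define U where "U = (\<Union>k<N. \<F> k)"
  have U: "finite U" unfolding U_def using fin by blast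
  have "\<exists>a l. 0 < l \<and> Q = cbox a (a + l *\<^sub>R One)" if "Q \<in> U" for Q
    using that sparse unfolding U_def sparse_def is_cube_def by blast
  then obtain a l where al: "\<And>Q. Q \<in> U \<Longrightarrow> 0 < l Q" "\<And>Q. Q \<in> U \<Longrightarrow> Q = cbox (a Q) (a Q + l Q *\<^sub>R One)"
    by metis
  \<comment> \<open>A bound for the position and size of all cubes at once. The added 1 in
    \<open>6 * m + 1\<close> makes the smallness conditions of the one-third trick strict.\<close>
  define m where "m = (\<Sum>Q\<in>U. norm (a Q) + l Q)"
  have m: "norm (a Q) + l Q \<le> m" if "Q \<in> U" for Q
    unfolding m_def using al(1) U that
    by (intro member_le_sum[of Q U "\<lambda>Q. norm (a Q) + l Q"] add_nonneg_nonneg norm_ge_zero)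
      (auto intro: less_imp_le)
  have m0: "0 \<le> m" unfolding m_def using al(1) by (intro sum_nonneg add_nonneg_nonneg) (auto intro: less_imp_le)
  define t where "t = log 2 (6 * m + 1)"
  have t: "2 powr t = 6 * m + 1" using m0 by (simp add: t_def)
  have "\<exists>A i R. A \<subseteq> Basis \<and> R \<in> desc i (top_cell t A) \<and> Q \<subseteq> cube_of R \<and> side R \<le> 6 * l Q"
    if Q: "Q \<in> U" for Q
  proof -
    have "\<bar>a Q \<bullet> b\<bar> < 2 powr t / 6" if "b \<in> Basis" for b
      using Basis_le_norm[OF that, of "a Q"] m[OF Q] al(1)[OF Q] unfolding t by simp
    moreover have "3 * l Q < 2 powr t"
      using norm_ge_zero[of "a Q"] m[OF Q] m0 unfolding t by linarith
    ultimately show ?thesis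
      using one_third_trick[OF al(1)[OF Q], of "a Q" t] al(2)[OF Q] by metis
  qed
  then obtain A i R where A: "\<And>Q. Q \<in> U \<Longrightarrow> A Q \<subseteq> Basis"
    and R: "\<And>Q. Q \<in> U \<Longrightarrow> R Q \<in> desc (i Q) (top_cell t (A Q))"
    and QR: "\<And>Q. Q \<in> U \<Longrightarrow> Q \<subseteq> cube_of (R Q)" "\<And>Q. Q \<in> U \<Longrightarrow> side (R Q) \<le> 6 * l Q"
    by metis
  define h where "h = (\<Sum>Q\<in>U. i Q)"
  have R_desc: "R Q \<in> desc h (top_cell t (A Q))" if "Q \<in> U" for Q
    using R[OF that] desc_mono[of "i Q" h] member_le_sum[of Q U i] U that unfolding h_def by blast
  have "\<exists>E. \<forall>k<N. (\<forall>Q\<in>\<F> k. E k Q \<in> sets lebesgue \<and> E k Q \<subseteq> Q \<and> measure lebesgue (E k Q) > measure lebesgue Q / 2)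
          \<and> disjoint_family_on (E k) (\<F> k)"
    using sparse unfolding sparse_def by metis
  then obtain E where E: "\<And>k Q. k < N \<Longrightarrow> Q \<in> \<F> k \<Longrightarrow> E k Q \<in> sets lebesgue"
      "\<And>k Q. k < N \<Longrightarrow> Q \<in> \<F> k \<Longrightarrow> E k Q \<subseteq> Q"
      "\<And>k Q. k < N \<Longrightarrow> Q \<in> \<F> k \<Longrightarrow> measure lebesgue (E k Q) > measure lebesgue Q / 2"
    and disj: "\<And>k. k < N \<Longrightarrow> disjoint_family_on (E k) (\<F> k)"
    by metis
  have F_U: "Q \<in> U" if "k < N" "Q \<in> \<F> k" for k Q using that by (auto simp: U_def)
  define X where "X j k c = (LINT x:cube_of c|lebesgue. norm (F j k x) powr p j)" for j k c
  define G where "G j x = lr_norm (r j) N (\<lambda>k. F j k x)" for j x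
  define B where "B j c = (LINT x:cube_of c|lebesgue. G j x powr p j)" for j c
  define e where "e j = recip (r j)" for j
  define tval where "tval k c = (\<Prod>j\<le>n. (X j k c / vol c) powr (1 / p j))" for k c
  define val where "val c = vol c * (\<Prod>j\<le>n. (B j c / vol c) powr (1 / p j))" for c
  define C0 where "C0 = sparse_const n p e DIM('a)"
  \<comment> \<open>The mass of the witness sets is moved to the cells. Several cubes may share a
    cell, which a weight tolerates; the Carleson condition follows since the sets
    \<open>E k Q\<close> are disjoint in \<open>Q\<close> and stay inside
    \<open>cube_of (R Q)\<close>.\<close>
  define w where "w D k c = (\<Sum>Q\<in>\<F> k. if A Q = D \<and> R Q = c then measure lebesgue (E k Q) else 0)" for D k c
  have w_sum: "(\<Sum>c\<in>desc h' s. w D k c * \<phi> c)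
      = (\<Sum>Q\<in>\<F> k. if A Q = D \<and> R Q \<in> desc h' s then measure lebesgue (E k Q) * \<phi> (R Q) else 0)"
    for D k h' s \<phi>
  proof -
    have "(\<Sum>c\<in>desc h' s. w D k c * \<phi> c) = (\<Sum>Q\<in>\<F> k. \<Sum>c\<in>desc h' s.
        if c = R Q then (if A Q = D then measure lebesgue (E k Q) * \<phi> c else 0) else 0)"
      unfolding w_def sum_distrib_right by (subst sum.swap) (intro sum.cong refl, auto)
    also have "\<dots> = (\<Sum>Q\<in>\<F> k. if R Q \<in> desc h' s then (if A Q = D then measure lebesgue (E k Q) * \<phi> (R Q) else 0) else 0)"
      by (intro sum.cong refl) (simp add: sum.delta)
    finally show ?thesis by (simp add: if_if_eq_conj conj_commute cong: if_cong)
  qed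
  have w_carleson: "sum (w D k) (desc h' c) \<le> vol c" if k: "k < N" for D k h' c
  proof -
    let ?P = "{Q \<in> \<F> k. A Q = D \<and> R Q \<in> desc h' c}"
    have sub: "E k Q \<subseteq> cube_of c" if "Q \<in> ?P" for Q
      using that E(2)[OF k] QR(1)[OF F_U[OF k]] desc_subset by blast
    have meas: "E k Q \<in> lmeasurable" if "Q \<in> ?P" for Q
      using that E(1)[OF k] sub[OF that] fmeasurableI2[OF cube_of_lmeasurable] by blast
    have "sum (w D k) (desc h' c) = (\<Sum>Q\<in>?P. measure lebesgue (E k Q))"
      using w_sum[of D k "\<lambda>_. 1" h' c, unfolded mult_1_right] fin[OF k] by (simp add: sum.inter_filter)
    also have "\<dots> = measure lebesgue (\<Union>Q\<in>?P. E k Q)"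
    proof (rule measure_finite_Union[symmetric])
      show "E k ` ?P \<subseteq> sets lebesgue" using meas by (auto simp: fmeasurableD)
      show "disjoint_family_on (E k) ?P" by (rule disjoint_family_on_mono[OF _ disj[OF k]]) blast
      show "emeasure lebesgue (E k Q) \<noteq> \<infinity>" if "Q \<in> ?P" for Q
        using fmeasurableD2[OF meas[OF that]] by simp
    qed (use fin[OF k] in simp)
    also have "\<dots> \<le> measure lebesgue (cube_of c)"
      using sub meas fin[OF k] by (intro measure_mono_fmeasurable UN_least) (auto intro!: sets.finite_UN)
    finally show ?thesis by simp
  qed
  have dom_ex: "0 \<le> C0 \<and> (\<exists>S. sparse_within (cube_of (top_cell t D)) S \<and>
      (\<Sum>c\<in>desc h (top_cell t D). \<Sum>k<N. w D k c * tval k c) \<le> C0 * (\<Sum>x\<in>S. val (fst x)))" for D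
  proof -
    interpret D: dyadic_data n N p e "w D" X B
      unfolding e_def X_def[abs_def] B_def[abs_def] G_def[abs_def]
    proof (rule dyadic_data_integrals[OF p r sum_r pr N F _ w_carleson])
      show "0 \<le> w D k c" for k c unfolding w_def by (intro sum_nonneg) simp
    qed
    show ?thesis
      using D.C0_nonneg D.dominated_all[of h "top_cell t D"]
      unfolding D.dominated_def D.form_def D.val_def tval_def val_def C0_def ..
  qed
  then have C0: "0 \<le> C0" by blast
  define good where "good D S \<longleftrightarrow> sparse_within (cube_of (top_cell t D)) S \<and>
      (\<Sum>c\<in>desc h (top_cell t D). \<Sum>k<N. w D k c * tval k c) \<le> C0 * (\<Sum>x\<in>S. val (fst x))" for D S
  have "\<exists>S. good D S" for D using dom_ex[of D] unfolding good_def by (rule conjunct2)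
  then obtain S where "\<And>D. good D (S D)" by metis
  then have S: "\<And>D. sparse_within (cube_of (top_cell t D)) (S D)"
    and dom: "\<And>D. (\<Sum>c\<in>desc h (top_cell t D). \<Sum>k<N. w D k c * tval k c) \<le> C0 * (\<Sum>x\<in>S D. val (fst x))"
    unfolding good_def by blast+
  \<comment> \<open>Families from different trees may overlap too much to be united, so the tree
    with the largest form stands in for all of them.\<close>
  obtain D0 where D0: "Max ((\<lambda>D. \<Sum>x\<in>S D. val (fst x)) ` Pow Basis) = (\<Sum>x\<in>S D0. val (fst x))"
    by (rule obtains_MAX[of "Pow Basis" "\<lambda>D. \<Sum>x\<in>S D. val (fst x)"]) auto
  have max: "(\<Sum>x\<in>S D. val (fst x)) \<le> (\<Sum>x\<in>S D0. val (fst x))" if "D \<in> Pow Basis" for D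
    using that unfolding D0[symmetric] by (intro Max_ge finite_imageI imageI) auto
  define \<Q> where "\<Q> = (\<lambda>x. closed_cube (fst x)) ` S D0"

  have one: "measure lebesgue Q * (\<Prod>j\<le>n. avg (p j) Q (F j k))
      \<le> 2 * (6 ^ DIM('a)) ^ (n + 1) * (measure lebesgue (E k Q) * tval k (R Q))"
    if k: "k < N" and Q: "Q \<in> \<F> k" for k Q
  proof -
    have avg_nn: "0 \<le> avg (p j) Q (F j k)" for j by (simp add: avg_def)
    have "(\<Prod>j\<le>n. avg (p j) Q (F j k))
        \<le> (\<Prod>j\<le>n. 6 ^ DIM('a) * (X j k (R Q) / vol (R Q)) powr (1 / p j))"
    proof (intro prod_mono conjI avg_nn)
      fix j assume "j \<in> {..n}"
      then have j: "j \<le> n" by simp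
      have QU: "Q \<in> U" by (rule F_U[OF k Q])
      have "avg (p j) (cbox (a Q) (a Q + l Q *\<^sub>R One)) (F j k)
        \<le> 6 ^ DIM('a) * ((LINT x:cube_of (R Q)|lebesgue. norm (F j k x) powr p j) / vol (R Q)) powr (1 / p j)"
        using integrable_norm_powr[OF F[OF j k] p[OF j]] p[OF j] al(1)[OF QU]
      proof (rule avg_le_cell_average)
        show "cbox (a Q) (a Q + l Q *\<^sub>R One) \<subseteq> cube_of (R Q)"
          using QR(1)[OF QU] al(2)[OF QU] by simp
      qed (rule QR(2)[OF QU])
      then show "avg (p j) Q (F j k) \<le> 6 ^ DIM('a) * (X j k (R Q) / vol (R Q)) powr (1 / p j)"
        unfolding X_def al(2)[OF QU, symmetric] .
    qed
    also have "\<dots> = (6 ^ DIM('a)) ^ (n + 1) * tval k (R Q)"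
      by (simp add: tval_def prod.distrib)
    finally have "measure lebesgue Q * (\<Prod>j\<le>n. avg (p j) Q (F j k))
      \<le> (2 * measure lebesgue (E k Q)) * ((6 ^ DIM('a)) ^ (n + 1) * tval k (R Q))"
      using E(3)[OF k Q] avg_nn by (intro mult_mono) (auto intro: prod_nonneg)
    then show ?thesis by (simp only: mult_ac)
  qed
  have split: "(\<Sum>k<N. \<Sum>Q\<in>\<F> k. measure lebesgue (E k Q) * tval k (R Q))
      = (\<Sum>D\<in>Pow Basis. \<Sum>c\<in>desc h (top_cell t D). \<Sum>k<N. w D k c * tval k c)"
  proof -
    have "(\<Sum>D\<in>Pow Basis. \<Sum>c\<in>desc h (top_cell t D). \<Sum>k<N. w D k c * tval k c)
      = (\<Sum>D\<in>Pow Basis. \<Sum>k<N. \<Sum>Q\<in>\<F> k.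
          if A Q = D \<and> R Q \<in> desc h (top_cell t D) then measure lebesgue (E k Q) * tval k (R Q) else 0)"
      unfolding w_sum[symmetric] by (intro sum.cong refl) (rule sum.swap)
    also have "\<dots> = (\<Sum>k<N. \<Sum>Q\<in>\<F> k. \<Sum>D\<in>Pow Basis.
          if A Q = D \<and> R Q \<in> desc h (top_cell t D) then measure lebesgue (E k Q) * tval k (R Q) else 0)"
      by (rule trans[OF sum.swap sum.cong[OF refl sum.swap]])
    also have "\<dots> = (\<Sum>k<N. \<Sum>Q\<in>\<F> k. measure lebesgue (E k Q) * tval k (R Q))"
    proof (intro sum.cong refl)
      fix k Q assume "k \<in> {..<N}" "Q \<in> \<F> k"
      then have QU: "Q \<in> U" using F_U by blast
      have "(\<Sum>D\<in>Pow Basis. if A Q = D \<and> R Q \<in> desc h (top_cell t D) then measure lebesgue (E k Q) * tval k (R Q) else 0)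
        = (\<Sum>D\<in>Pow Basis. if A Q = D then measure lebesgue (E k Q) * tval k (R Q) else 0)"
        using R_desc[OF QU] by (intro sum.cong refl) auto
      also have "\<dots> = measure lebesgue (E k Q) * tval k (R Q)"
        using A[OF QU] by (subst sum.delta') auto
      finally show "(\<Sum>D\<in>Pow Basis. if A Q = D \<and> R Q \<in> desc h (top_cell t D) then measure lebesgue (E k Q) * tval k (R Q) else 0)
        = measure lebesgue (E k Q) * tval k (R Q)" .
    qed
    finally show ?thesis by simp
  qed
  have "(\<Sum>k<N. \<Sum>Q\<in>\<F> k. measure lebesgue Q * (\<Prod>j\<le>n. avg (p j) Q (F j k)))
    \<le> (\<Sum>k<N. \<Sum>Q\<in>\<F> k. 2 * (6 ^ DIM('a)) ^ (n + 1) * (measure lebesgue (E k Q) * tval k (R Q)))"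
    by (intro sum_mono one) auto
  also have "\<dots> = 2 * (6 ^ DIM('a)) ^ (n + 1) *
      (\<Sum>D\<in>Pow Basis. \<Sum>c\<in>desc h (top_cell t D). \<Sum>k<N. w D k c * tval k c)"
    unfolding split[symmetric] by (simp only: sum_distrib_left)
  also have "\<dots> \<le> 2 * (6 ^ DIM('a)) ^ (n + 1) * (\<Sum>D\<in>Pow (Basis :: 'a set). C0 * (\<Sum>x\<in>S D0. val (fst x)))"
    using C0 by (intro mult_left_mono sum_mono order_trans[OF dom] max) auto
  also have "\<dots> = domination_const n p r DIM('a) * (\<Sum>x\<in>S D0. val (fst x))"
    by (simp add: domination_const_def C0_def e_def[abs_def] card_Pow)
  also have "\<dots> \<le> domination_const n p r DIM('a) *
      (\<Sum>x\<in>S D0. measure lebesgue (closed_cube (fst x)) * (\<Prod>j\<le>n. avg (p j) (closed_cube (fst x)) (G j)))"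
  proof (intro mult_left_mono sum_mono)
    fix x
    show "val (fst x) \<le> measure lebesgue (closed_cube (fst x)) * (\<Prod>j\<le>n. avg (p j) (closed_cube (fst x)) (G j))"
      unfolding val_def measure_closed_cube
    proof (intro mult_left_mono prod_mono conjI)
      fix j assume "j \<in> {..n}"
      then have j: "j \<le> n" by simp
      have nG: "norm (G j x) = G j x" for x using lr_norm_nonneg[OF N] by (simp add: G_def)
      have "integrable lebesgue (\<lambda>x. norm (G j x) powr p j)"
        unfolding nG unfolding G_def using integrable_lr_norm_powr[OF r[OF j] N F[OF j] p[OF j]] by simp
      from cell_average_le_avg[OF this p[OF j], of "fst x"]
      show "(B j (fst x) / vol (fst x)) powr (1 / p j) \<le> avg (p j) (closed_cube (fst x)) (G j)"
        unfolding B_def nG .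
    qed auto
  qed (use C0 in \<open>auto simp: domination_const_def C0_def e_def[abs_def]\<close>)
  also have "\<dots> = domination_const n p r DIM('a) *
      (\<Sum>Q\<in>\<Q>. measure lebesgue Q * (\<Prod>j\<le>n. avg (p j) Q (G j)))"
    unfolding \<Q>_def by (subst sum.reindex[OF inj_on_closed_cube[OF S]]) simp
  finally show ?thesis
    using sparse_closed_cubes[OF S, of D0] S[of D0]
    unfolding G_def \<Q>_def by (intro exI[of _ "(\<lambda>x. closed_cube (fst x)) ` S D0"]) (simp add: sparse_within_def)
qed

section \<open>From scalar sparse bounds to the vector-valued bound\<close>

lemma avg_nonneg: "0 \<le> avg p Q f"
  by (simp add: avg_def)

lemma sparse_subset: "sparse \<Q> \<Longrightarrow> \<F> \<subseteq> \<Q> \<Longrightarrow> sparse \<F>"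
proof -
  assume sub: "\<F> \<subseteq> \<Q>" and "sparse \<Q>"
  then obtain E where "countable \<Q>" and Q: "\<forall>Q\<in>\<Q>. is_cube Q"
    and E: "\<forall>Q\<in>\<Q>. E Q \<in> sets lebesgue \<and> E Q \<subseteq> Q \<and> measure lebesgue (E Q) > measure lebesgue Q / 2"
    "disjoint_family_on E \<Q>"
    unfolding sparse_def by blast
  show "sparse \<F>"
    unfolding sparse_def
    using countable_subset[OF sub \<open>countable \<Q>\<close>] Q E(1) disjoint_family_on_mono[OF sub E(2)] sub by blast
qed

text \<open>The infinite sum is the supremum of its finite partial sums. Giving up a factor 2
  creates the strict inequality needed to exceed the target by one of them.\<close>

lemma finite_subfamily_half:
  fixes \<phi> :: "'b \<Rightarrow> real"
  assumes \<phi>: "\<And>Q. 0 \<le> \<phi> Q" and t: "0 < t"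
    and le: "ennreal y \<le> ennreal t * (\<Sum>\<^sub>\<infinity>Q\<in>\<Q>. ennreal (\<phi> Q))"
  shows "\<exists>\<F>. finite \<F> \<and> \<F> \<subseteq> \<Q> \<and> y \<le> 2 * t * sum \<phi> \<F>"
proof (cases "y \<le> 0")
  case False
  have "ennreal (y / (2 * t)) < (\<Sum>\<^sub>\<infinity>Q\<in>\<Q>. ennreal (\<phi> Q))"
  proof (rule ccontr)
    assume "\<not> ennreal (y / (2 * t)) < (\<Sum>\<^sub>\<infinity>Q\<in>\<Q>. ennreal (\<phi> Q))"
    then have "ennreal y \<le> ennreal t * ennreal (y / (2 * t))"
      by (intro order_trans[OF le] mult_left_mono) (auto simp: not_less)
    also have "\<dots> = ennreal (t * (y / (2 * t)))"
      using t False by (intro ennreal_mult[symmetric]) auto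
    also have "t * (y / (2 * t)) = y / 2" using t by simp
    finally show False using False by (simp add: ennreal_le_iff2)
  qed
  also have "(\<Sum>\<^sub>\<infinity>Q\<in>\<Q>. ennreal (\<phi> Q)) = (SUP F\<in>{F. finite F \<and> F \<subseteq> \<Q>}. \<Sum>Q\<in>F. ennreal (\<phi> Q))"
    by (rule nonneg_infsum_complete) simp
  finally obtain F where F: "finite F" "F \<subseteq> \<Q>" "ennreal (y / (2 * t)) < (\<Sum>Q\<in>F. ennreal (\<phi> Q))"
    unfolding less_SUP_iff by blast
  then have "y / (2 * t) < sum \<phi> F"
    using False t by (simp add: sum_ennreal \<phi> ennreal_less_iff)
  then have "y \<le> 2 * t * sum \<phi> F" using t by (simp add: field_simps)
  then show ?thesis using F by blast
qed (intro exI[of _ "{}"], simp)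

lemma sparse_bound_mono:
  assumes "sparse_bound n p T C" "C \<le> C'" shows "sparse_bound n p T C'"
proof -
  have "ennreal C * x \<le> ennreal C' * x" for x
    using assms(2) by (intro mult_right_mono ennreal_leI) auto
  then show ?thesis using assms(1) unfolding sparse_bound_def by (meson order_trans)
qed

lemma sparse_norm_less_imp_bound:
  assumes "sparse_norm n p T < ennreal t" shows "sparse_bound n p T t"
proof -
  from assms obtain C where C: "0 < C" "sparse_bound n p T C" "ennreal C < ennreal t"
    unfolding sparse_norm_def Inf_less_iff by blast
  then have "C \<le> t" by (simp add: ennreal_less_iff less_imp_le)
  then show ?thesis by (rule sparse_bound_mono[OF C(2)])
qed

lemma prod_atMost_split: "(\<Prod>j\<le>n. f j) = (\<Prod>j<n. f j) * f n" for f :: "nat \<Rightarrow> real"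
  by (simp add: prod.lessThan_Suc flip: lessThan_Suc_atMost)

lemma vsparse_bound_of_sparse_bound:
  fixes T :: "nat \<Rightarrow> (nat \<Rightarrow> 'a::euclidean_space \<Rightarrow> complex) \<Rightarrow> 'a \<Rightarrow> complex"
  assumes p: "\<And>j. j \<le> n \<Longrightarrow> 1 \<le> p j" and r: "\<And>j. j \<le> n \<Longrightarrow> 1 \<le> r j"
    and sum_r: "(\<Sum>j\<le>n. recip (r j)) = 1" and pr: "\<And>j. j \<le> n \<Longrightarrow> ereal (p j) < r j"
    and N: "1 \<le> N" and t: "0 < t" and T: "\<And>k. k < N \<Longrightarrow> sparse_bound n p (T k) t"
    and C: "0 < C" "2 * domination_const n p r DIM('a) \<le> C"
  shows "vsparse_bound n p r N T (C * t)"
  unfolding vsparse_bound_def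
proof (intro ballI allI impI)
  fix F :: "nat \<Rightarrow> nat \<Rightarrow> 'a \<Rightarrow> complex" and H :: "nat \<Rightarrow> 'a \<Rightarrow> complex"
  assume F: "F \<in> vtuples n N" and H: "\<forall>k<N. H k \<in> Linf0"
  \<comment> \<open>The dual function joins the others as index \<open>n\<close>, so that all
    \<open>n + 1\<close> slots are treated symmetrically.\<close>
  define G where "G j k = (if j < n then F j k else H k)" for j k
  define \<phi> where "\<phi> k Q = measure lebesgue Q * (\<Prod>j\<le>n. avg (p j) Q (G j k))" for k Q
  define \<psi> where "\<psi> Q = measure lebesgue Q * (\<Prod>j\<le>n. avg (p j) Q (\<lambda>x. lr_norm (r j) N (\<lambda>k. G j k x)))" for Q
  have \<phi>: "0 \<le> \<phi> k Q" for k Q unfolding \<phi>_def by (intro mult_nonneg_nonneg prod_nonneg avg_nonneg) simp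
  have \<psi>: "0 \<le> \<psi> Q" for Q unfolding \<psi>_def by (intro mult_nonneg_nonneg prod_nonneg avg_nonneg) simp
  have \<phi>_eq: "measure lebesgue Q * (\<Prod>j<n. avg (p j) Q (F j k)) * avg (p n) Q (H k) = \<phi> k Q" for k Q
    by (simp add: \<phi>_def G_def prod_atMost_split mult.assoc)
  have \<psi>_eq: "measure lebesgue Q * (\<Prod>j<n. avg (p j) Q (\<lambda>x. lr_norm (r j) N (\<lambda>k. F j k x)))
      * avg (p n) Q (\<lambda>x. lr_norm (r n) N (\<lambda>k. H k x)) = \<psi> Q" for Q
    by (simp add: \<psi>_def G_def prod_atMost_split mult.assoc)
  have "\<exists>\<F>. finite \<F> \<and> sparse \<F> \<and> norm (pairing (T k (\<lambda>j. F j k)) (H k)) \<le> 2 * t * sum (\<phi> k) \<F>"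
    if k: "k < N" for k
  proof -
    have "(\<lambda>j. F j k) \<in> tuples n" using F k by (auto simp: vtuples_def tuples_def)
    then obtain \<Q> where \<Q>: "sparse \<Q>"
      "ennreal (norm (pairing (T k (\<lambda>j. F j k)) (H k))) \<le> ennreal t * (\<Sum>\<^sub>\<infinity>Q\<in>\<Q>. ennreal (\<phi> k Q))"
      using T[OF k] H k unfolding sparse_bound_def \<phi>_eq[symmetric] by blast
    from finite_subfamily_half[OF \<phi> t \<Q>(2)] sparse_subset[OF \<Q>(1)] show ?thesis by blast
  qed
  then obtain \<F> where \<F>: "\<And>k. k < N \<Longrightarrow> finite (\<F> k)" "\<And>k. k < N \<Longrightarrow> sparse (\<F> k)"
    and le: "\<And>k. k < N \<Longrightarrow> norm (pairing (T k (\<lambda>j. F j k)) (H k)) \<le> 2 * t * sum (\<phi> k) (\<F> k)"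
    by metis
  have G: "G j k \<in> Linf0" if "j \<le> n" "k < N" for j k
    using F H that by (auto simp: G_def vtuples_def)
  have "\<exists>\<Q>. finite \<Q> \<and> sparse \<Q> \<and>
      (\<Sum>k<N. sum (\<phi> k) (\<F> k)) \<le> domination_const n p r DIM('a) * sum \<psi> \<Q>"
    unfolding \<phi>_def[abs_def] \<psi>_def[abs_def]
    by (rule sparse_form_domination[OF p r sum_r pr N G \<F>])
  then obtain \<Q> where \<Q>: "finite \<Q>" "sparse \<Q>"
    "(\<Sum>k<N. sum (\<phi> k) (\<F> k)) \<le> domination_const n p r DIM('a) * sum \<psi> \<Q>" by blast
  have "norm (\<Sum>k<N. pairing (T k (\<lambda>j. F j k)) (H k)) \<le> (\<Sum>k<N. 2 * t * sum (\<phi> k) (\<F> k))"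
    by (intro sum_norm_le) (simp add: le)
  also have "\<dots> = 2 * t * (\<Sum>k<N. sum (\<phi> k) (\<F> k))" by (simp only: sum_distrib_left)
  also have "\<dots> \<le> 2 * t * (domination_const n p r DIM('a) * sum \<psi> \<Q>)"
    using \<Q>(3) t by (intro mult_left_mono) auto
  also have "\<dots> = (2 * domination_const n p r DIM('a)) * (t * sum \<psi> \<Q>)" by simp
  also have "\<dots> \<le> C * (t * sum \<psi> \<Q>)"
    using C t \<psi> by (intro mult_right_mono mult_nonneg_nonneg sum_nonneg) auto
  finally have "ennreal (norm (\<Sum>k<N. pairing (T k (\<lambda>j. F j k)) (H k))) \<le> ennreal (C * t * sum \<psi> \<Q>)"
    by (intro ennreal_leI) (simp add: mult.assoc)
  also have "\<dots> = ennreal (C * t) * (\<Sum>\<^sub>\<infinity>Q\<in>\<Q>. ennreal (\<psi> Q))"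
    using \<Q>(1) C t \<psi> by (subst ennreal_mult) (auto simp: sum_nonneg)
  finally show "\<exists>\<Q>. sparse \<Q> \<and>
        ennreal (norm (\<Sum>k<N. pairing (T k (\<lambda>j. F j k)) (H k))) \<le>
          ennreal (C * t) * (\<Sum>\<^sub>\<infinity>Q\<in>\<Q>. ennreal (measure lebesgue Q
              * (\<Prod>j<n. avg (p j) Q (\<lambda>x. lr_norm (r j) N (\<lambda>k. F j k x)))
              * avg (p n) Q (\<lambda>x. lr_norm (r n) N (\<lambda>k. H k x))))"
    unfolding \<psi>_eq using \<Q>(2) by blast
qed

theorem theorem1p1:
  fixes n :: nat and p :: "nat \<Rightarrow> real" and r :: "nat \<Rightarrow> ereal"
  assumes "n \<ge> 1"
    and "\<forall>j\<le>n. p j \<ge> 1"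
    and "\<forall>j\<le>n. r j \<ge> 1"
    and "(\<Sum>j<n. recip (r j)) + recip (r n) = 1"
    and "\<forall>j\<le>n. r j > ereal (p j)"
  shows "\<exists>C::real. C > 0 \<and>
    (\<forall>N::nat. \<forall>T :: nat \<Rightarrow> (nat \<Rightarrow> 'a::euclidean_space \<Rightarrow> complex) \<Rightarrow> 'a \<Rightarrow> complex.
       N \<ge> 1 \<longrightarrow> (\<forall>k<N. nsublinear n (T k)) \<longrightarrow>
       vsparse_norm n p r N T \<le> ennreal C * (SUP k\<in>{..<N}. sparse_norm n p (T k)))"
proof -
  \<comment> \<open>The maximum with 1 secures positivity of \<open>C\<close>, by which
    \<open>\<epsilon>\<close> is divided below.\<close>
  define C where "C = max 1 (2 * domination_const n p r DIM('a))"
  have C: "0 < C" "2 * domination_const n p r DIM('a) \<le> C" by (auto simp: C_def)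
  have sum_r: "(\<Sum>j\<le>n. recip (r j)) = 1"
    using assms(4) by (simp flip: lessThan_Suc_atMost)
  have "vsparse_norm n p r N T \<le> ennreal C * (SUP k\<in>{..<N}. sparse_norm n p (T k))"
    if N: "1 \<le> N" for N and T :: "nat \<Rightarrow> (nat \<Rightarrow> 'a \<Rightarrow> complex) \<Rightarrow> 'a \<Rightarrow> complex"
  proof (rule ennreal_le_epsilon)
    fix \<epsilon> :: real
    let ?s = "SUP k\<in>{..<N}. sparse_norm n p (T k)"
    assume fin: "ennreal C * ?s < top" and \<epsilon>: "0 < \<epsilon>"
    have "?s \<noteq> top"
    proof
      assume "?s = top"
      with fin C(1) show False by (simp add: ennreal_mult_top)
    qed
    then obtain s where s: "?s = ennreal s" "0 \<le> s" by (cases ?s) auto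
    \<comment> \<open>Room above the supremum is left because the infimum in
      \<open>sparse_norm\<close> need not be attained; multiplied by \<open>C\<close>, this room
      becomes \<open>\<epsilon>\<close>.\<close>
    define t where "t = s + \<epsilon> / C"
    have t: "0 < t" "s < t" using s(2) \<epsilon> C(1) by (auto simp: t_def add_nonneg_pos)
    have "sparse_bound n p (T k) t" if "k < N" for k
    proof (rule sparse_norm_less_imp_bound)
      have "sparse_norm n p (T k) \<le> ?s" using that by (intro SUP_upper) auto
      also have "\<dots> < ennreal t" using s t by (simp add: ennreal_less_iff)
      finally show "sparse_norm n p (T k) < ennreal t" .
    qed
    then have "vsparse_bound n p r N T (C * t)"
      using assms(2,3,5) sum_r N t(1) C by (intro vsparse_bound_of_sparse_bound) auto
    then have "vsparse_norm n p r N T \<le> ennreal (C * t)"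
      unfolding vsparse_norm_def using C(1) t(1) by (intro Inf_lower) auto
    also have "C * t = C * s + \<epsilon>" using C(1) by (simp add: t_def field_simps)
    also have "ennreal (C * s + \<epsilon>) = ennreal C * ?s + ennreal \<epsilon>"
      using s C(1) \<epsilon> by (simp add: ennreal_plus ennreal_mult less_imp_le)
    finally show "vsparse_norm n p r N T \<le> ennreal C * ?s + ennreal \<epsilon>" .
  qed
  then show ?thesis using C(1) by blast
qed

end
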